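(* Let $\Omega_i=\mathbb R^p$ for all $i$, let $\mathcal G$ be connected, let $\mathbf L=U^\top U$ satisfy the graph and null-space conditions given in the context, and let each $f_i$ have $L_i$-Lipschitz gradient and be $\mu_i$-strongly convex ($\mu_i>0$); set $\mu=\min_i\mu_i$, $L=\max_iL_i$, $\kappa_{\mathbf f}=L/\mu$ (the condition number of the objective function $\mathbf f$) and $\kappa_{\mathbf L}=1/\tilde\lambda_{\min}(\mathbf L)$. Consider Mirror-P-EXTRA with $B\succcurlyeq c\mathbf L$ and, further, $B=\beta I$. Then, with appropriate settings of the parameters $\beta>0$ and $c>0$, the number of iterations needed to reach $\varepsilon$-accuracy is of the order $$O\Big(\big(\kappa_{\mathbf L}+\sqrt{\kappa_{\mathbf L}\kappa_{\mathbf f}}\big)\ln\big(\tfrac1\varepsilon\big)\Big),$$ i.e. there is a universal constant $C>0$ such that, for this choice of parameters, for every $\varepsilon\in(0,1)$ and every integer $k\ge C\,(\kappa_{\mathbf L}+\sqrt{\kappa_{\mathbf L}\kappa_{\mathbf f}})\ln(1/\varepsilon)$, $$\|\mathbf z^k-\mathbf z^*\|_{\mathcal M}^2\le\varepsilon\,\|\mathbf z^0-\mathbf z^*\|_{\mathcal M}^2 .$$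
   Context: Problem. There are $n$ agents; agent $i$ has $f_i:\mathbb R^p\to\mathbb R$ and $r_i\in\mathbb R^p$, and in general a local constraint set $\Omega_i\subseteq\mathbb R^p$ for its variable $x_i$; here $\Omega_i=\mathbb R^p$. The (unconstrained) resource allocation problem is: minimize $\mathbf f(\mathbf x)=\sum_{i=1}^n f_i(x_i)$ subject to $\sum_{i=1}^n(x_i-r_i)=0$. Points are matrices $\mathbf x\in\mathbb R^{n\times p}$ with $i$-th row $x_i^\top$; $\mathbf r$ has rows $r_i^\top$; $\nabla\mathbf f(\mathbf x)$ is the matrix with rows $(\nabla f_i(x_i))^\top$. A function $f$ is $\mu$-strongly convex if $\langle \nabla f(x)-\nabla f(y),x-y\rangle\ge\mu\|x-y\|_2^2$ for all $x,y$; its gradient is $L$-Lipschitz if $\|\nabla f(x)-\nabla f(y)\|_2\le L\|x-y\|_2$ for all $x,y$. $\tilde\lambda_{\min}$ denotes the smallest nonzero eigenvalue of a symmetric positive semidefinite matrix, and $A\succcurlyeq A'$ means that $A-A'$ is positive semidefinite. Graph. $\mathcal G$ is a simple undirected graph on $\{1,\dots,n\}$ with edge set $\mathcal E$ and neighbor sets $\mathcal N_i$. The $n\times n$ matrix $\mathbf L=[L_{ij}]$ is compatible with $\mathcal G$ (that is, $L_{ij}=0$ whenever $i\ne j$ and $\{i,j\}\notin\mathcal E$) and $\mathbf L=U^\top U$ for some full-row-rank $U\in\mathbb R^{(n-1)\times n}$ with null space $\{a\mathbf 1: a\in\mathbb R\}$, where $\mathbf 1$ is the all-ones vector. Algorithm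 (Mirror-P-EXTRA, with $\Omega_i=\mathbb R^p$). Each agent $i$ has $\beta_i>0$; all share $c>0$; $B=\mathrm{diag}(\beta_1,\dots,\beta_n)$. Initialize $x_i^0\in\mathbb R^p$, $s_i^0=\nabla f_i(x_i^0)$, $y_i^{-1}=0$. For $k=0,1,\dots$: $y_i^k=y_i^{k-1}+\sum_{j\in\mathcal N_i\cup\{i\}}L_{ij}s_j^k$; $x_i^{k+1}=\arg\min_{x_i\in\mathbb R^p}\{f_i(x_i)-\langle s_i^k,x_i\rangle+\frac1{2\beta_i}\|x_i-r_i+2cy_i^k-cy_i^{k-1}\|_2^2\}$; $s_i^{k+1}=s_i^k-\frac1{\beta_i}(x_i^{k+1}-r_i+2cy_i^k-cy_i^{k-1})$. Define $\mathbf q^{-1}=0$, $\mathbf q^{k}=\mathbf q^{k-1}+U\nabla\mathbf f(\mathbf x^k)$ for $k\ge0$, and $$\mathcal M=\begin{pmatrix}cI&0\\0&B-c\mathbf L\end{pmatrix},\quad \mathbf z^k=\begin{pmatrix}\mathbf q^k\\ \nabla\mathbf f(\mathbf x^k)\end{pmatrix},\quad \mathbf z^*=\begin{pmatrix}\mathbf q^*\\ \nabla\mathbf f(\mathbf x^* )\end{pmatrix},$$ where $\mathbf x^*$ is the optimal solution and $\mathbf q^*\in\mathbb R^{(n-1)\times p}$ satisfies $\mathbf x^*-\mathbf r+cU^\top\mathbf q^*=0$. $\|A\|_{\mathcal M}=\sqrt{\mathrm{Trace}(A^\top\mathcal MA)}$ (a seminorm when $\mathcal M$ is positive semidefinite)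.
   Formalization: The iteration bound carries an extra factor max(1, λ_max(L)), equal to 1 when λ_max(L) ≤ 1; without it no universal C exists, since scaling L by t and c by 1/t keeps the run but divides κ_L by t. Also n ≥ 2, p ≥ 1 is assumed (κ_L is undefined for n = 1). *)

theory Defs
  imports
    Complex_Main
    "Jordan_Normal_Form.Char_Poly"
    "Jordan_Normal_Form.Matrix_Kernel"
    "Jordan_Normal_Form.DL_Rank"
    "Graph_Theory.Graph_Theory"
begin

text \<open>
  Vectors and matrices carry explicit dimensions, so that the numbers \<open>n\<close> of agents and \<open>p\<close> of
  coordinates can be quantified over inside a formula.  Agents are numbered \<open>0, \<dots>, n - 1\<close>.
\<close>

section \<open>Gradients, strong convexity, Lipschitz gradients\<close>

definition vec_norm2 :: "real vec \<Rightarrow> real" where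
  "vec_norm2 v = sqrt (v \<bullet> v)"

definition has_gradient :: "nat \<Rightarrow> (real vec \<Rightarrow> real) \<Rightarrow> real vec \<Rightarrow> real vec \<Rightarrow> bool" where
  "has_gradient p f g x \<longleftrightarrow> g \<in> carrier_vec p \<and>
     (\<forall>e>0. \<exists>d>0. \<forall>y\<in>carrier_vec p. vec_norm2 (y - x) < d \<longrightarrow>
        \<bar>f y - f x - g \<bullet> (y - x)\<bar> \<le> e * vec_norm2 (y - x))"

definition grad :: "nat \<Rightarrow> (real vec \<Rightarrow> real) \<Rightarrow> real vec \<Rightarrow> real vec" where
  "grad p f x = (THE g. has_gradient p f g x)"

definition differentiable_vec :: "nat \<Rightarrow> (real vec \<Rightarrow> real) \<Rightarrow> bool" where
  "differentiable_vec p f \<longleftrightarrow> (\<forall>x\<in>carrier_vec p. \<exists>g. has_gradient p f g x)"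

definition strongly_convex :: "nat \<Rightarrow> real \<Rightarrow> (real vec \<Rightarrow> real) \<Rightarrow> bool" where
  "strongly_convex p \<mu> f \<longleftrightarrow> differentiable_vec p f \<and>
     (\<forall>x\<in>carrier_vec p. \<forall>y\<in>carrier_vec p.
        (grad p f x - grad p f y) \<bullet> (x - y) \<ge> \<mu> * (vec_norm2 (x - y))\<^sup>2)"

definition lipschitz_gradient :: "nat \<Rightarrow> real \<Rightarrow> (real vec \<Rightarrow> real) \<Rightarrow> bool" where
  "lipschitz_gradient p L f \<longleftrightarrow> differentiable_vec p f \<and>
     (\<forall>x\<in>carrier_vec p. \<forall>y\<in>carrier_vec p.
        vec_norm2 (grad p f x - grad p f y) \<le> L * vec_norm2 (x - y))"

definition grad_rows :: "nat \<Rightarrow> nat \<Rightarrow> (nat \<Rightarrow> real vec \<Rightarrow> real) \<Rightarrow> real mat \<Rightarrow> real mat" where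
  "grad_rows n p f X = mat n p (\<lambda>(i, j). grad p (f i) (row X i) $ j)"

section \<open>Matrices\<close>

definition pos_semidef :: "nat \<Rightarrow> real mat \<Rightarrow> bool" where
  "pos_semidef n A \<longleftrightarrow> A \<in> carrier_mat n n \<and> A\<^sup>T = A \<and> (\<forall>v\<in>carrier_vec n. 0 \<le> v \<bullet> (A *\<^sub>v v))"

definition loewner_ge :: "nat \<Rightarrow> real mat \<Rightarrow> real mat \<Rightarrow> bool" where
  "loewner_ge n A A' \<longleftrightarrow> pos_semidef n (A - A')"

definition min_nonzero_eigenvalue :: "real mat \<Rightarrow> real" where
  "min_nonzero_eigenvalue A = Min {l. eigenvalue A l \<and> l \<noteq> 0}"

definition max_eigenvalue :: "real mat \<Rightarrow> real" where
  "max_eigenvalue A = Max {l. eigenvalue A l}"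

definition mat_trace :: "real mat \<Rightarrow> real" where
  "mat_trace A = (\<Sum>i<dim_row A. A $$ (i, i))"

definition mat_seminorm :: "real mat \<Rightarrow> real mat \<Rightarrow> real" where
  "mat_seminorm M A = sqrt (mat_trace (A\<^sup>T * M * A))"

section \<open>Graph and the matrix L\<close>

text \<open>
  A simple undirected graph is a finite, symmetric, loop-free digraph without parallel arcs; the
  edge \<open>{i, j}\<close> is represented by the two arcs \<open>(i, j)\<close> and \<open>(j, i)\<close>.
\<close>

definition connected_graph_on :: "nat \<Rightarrow> nat pair_pre_digraph \<Rightarrow> bool" where
  "connected_graph_on n G \<longleftrightarrow> pair_graph G \<and> pverts G = {..<n} \<and>
     Digraph_Component.connected (with_proj G)"

definition neighbors :: "nat pair_pre_digraph \<Rightarrow> nat \<Rightarrow> nat set" where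
  "neighbors G i = {j. (i, j) \<in> parcs G}"

definition graph_compatible :: "nat \<Rightarrow> nat pair_pre_digraph \<Rightarrow> real mat \<Rightarrow> bool" where
  "graph_compatible n G W \<longleftrightarrow> W \<in> carrier_mat n n \<and>
     (\<forall>i<n. \<forall>j<n. i \<noteq> j \<and> (i, j) \<notin> parcs G \<longrightarrow> W $$ (i, j) = 0)"

definition factor_cond :: "nat \<Rightarrow> real mat \<Rightarrow> bool" where
  "factor_cond n U \<longleftrightarrow> U \<in> carrier_mat (n - 1) n \<and> vec_space.rank (n - 1) U = n - 1 \<and>
     mat_kernel U = {a \<cdot>\<^sub>v vec n (\<lambda>_. 1) | a. True}"

section \<open>Resource allocation and Mirror-P-EXTRA\<close>

definition optimal_allocation ::
    "nat \<Rightarrow> nat \<Rightarrow> (nat \<Rightarrow> real vec \<Rightarrow> real) \<Rightarrow> real mat \<Rightarrow> real mat \<Rightarrow> bool" where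
  "optimal_allocation n p f r X \<longleftrightarrow>
     is_arg_min (\<lambda>Y. \<Sum>i<n. f i (row Y i))
       (\<lambda>Y. Y \<in> carrier_mat n p \<and> (\<forall>l<p. (\<Sum>i<n. Y $$ (i, l) - r $$ (i, l)) = 0)) X"

text \<open>
  \<open>x k\<close>, \<open>s k\<close> and \<open>y k\<close> are the matrices whose \<open>i\<close>-th rows are the variables of agent \<open>i\<close>.
  The sequence \<open>y\<close> starts at index \<open>-1\<close>; its values below \<open>-1\<close> are irrelevant.
\<close>

definition mirror_p_extra ::
    "nat \<Rightarrow> nat \<Rightarrow> nat pair_pre_digraph \<Rightarrow> real mat \<Rightarrow> (nat \<Rightarrow> real vec \<Rightarrow> real) \<Rightarrow> real mat \<Rightarrow>
     (nat \<Rightarrow> real) \<Rightarrow> real \<Rightarrow> (nat \<Rightarrow> real mat) \<Rightarrow> (nat \<Rightarrow> real mat) \<Rightarrow> (int \<Rightarrow> real mat) \<Rightarrow> bool" where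
  "mirror_p_extra n p G W f r b c x s y \<longleftrightarrow>
     (\<forall>k. x k \<in> carrier_mat n p \<and> s k \<in> carrier_mat n p) \<and>
     (\<forall>k\<ge>-1. y k \<in> carrier_mat n p) \<and>
     y (-1) = 0\<^sub>m n p \<and>
     (\<forall>i<n. row (s 0) i = grad p (f i) (row (x 0) i)) \<and>
     (\<forall>k::nat. \<forall>i<n.
        row (y (int k)) i = row (y (int k - 1)) i
          + vec p (\<lambda>l. \<Sum>j\<in>neighbors G i \<union> {i}. W $$ (i, j) * s k $$ (j, l)) \<and>
        is_arg_min
          (\<lambda>v. f i v - row (s k) i \<bullet> v
             + 1 / (2 * b i) * (vec_norm2 (v - row r i + (2 * c) \<cdot>\<^sub>v row (y (int k)) i
                                           - c \<cdot>\<^sub>v row (y (int k - 1)) i))\<^sup>2)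
          (\<lambda>v. v \<in> carrier_vec p) (row (x (Suc k)) i) \<and>
        row (s (Suc k)) i = row (s k) i
          - (1 / b i) \<cdot>\<^sub>v (row (x (Suc k)) i - row r i + (2 * c) \<cdot>\<^sub>v row (y (int k)) i
                           - c \<cdot>\<^sub>v row (y (int k - 1)) i))"

definition q_sequence ::
    "nat \<Rightarrow> nat \<Rightarrow> real mat \<Rightarrow> (nat \<Rightarrow> real vec \<Rightarrow> real) \<Rightarrow> (nat \<Rightarrow> real mat) \<Rightarrow>
     (int \<Rightarrow> real mat) \<Rightarrow> bool" where
  "q_sequence n p U f x q \<longleftrightarrow> q (-1) = 0\<^sub>m (n - 1) p \<and>
     (\<forall>k::nat. q (int k) = q (int k - 1) + U * grad_rows n p f (x k))"

definition metric_mat :: "nat \<Rightarrow> real \<Rightarrow> real mat \<Rightarrow> real mat \<Rightarrow> real mat" where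
  "metric_mat n c B W =
     four_block_mat (c \<cdot>\<^sub>m 1\<^sub>m (n - 1)) (0\<^sub>m (n - 1) n) (0\<^sub>m n (n - 1)) (B - c \<cdot>\<^sub>m W)"

definition z_mat ::
    "nat \<Rightarrow> nat \<Rightarrow> (nat \<Rightarrow> real vec \<Rightarrow> real) \<Rightarrow> real mat \<Rightarrow> real mat \<Rightarrow> real mat" where
  "z_mat n p f Q X = Q @\<^sub>r grad_rows n p f X"

section \<open>Condition numbers\<close>

definition kappa_f :: "nat \<Rightarrow> (nat \<Rightarrow> real) \<Rightarrow> (nat \<Rightarrow> real) \<Rightarrow> real" where
  "kappa_f n \<mu> Lc = Max (Lc ` {..<n}) / Min (\<mu> ` {..<n})"

text \<open>
  \<open>1 / min_nonzero_eigenvalue W\<close> is a condition number only for \<open>W\<close> normalized to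
  \<open>max_eigenvalue W \<le> 1\<close>: replacing \<open>(W, c)\<close> by \<open>(t W, c / t)\<close> leaves the iterates and the
  seminorm unchanged but divides \<open>kappa_L\<close> by \<open>t\<close>.  An iteration bound that holds for every
  scaling therefore carries the factor \<open>max 1 (max_eigenvalue W)\<close>, which is \<open>1\<close> for
  normalized \<open>W\<close>.
\<close>

definition kappa_L :: "real mat \<Rightarrow> real" where
  "kappa_L W = 1 / min_nonzero_eigenvalue W"

end

theory Submission
  imports Defs
begin

text \<open>
  The optimality condition of the inner minimization turns the update of \<open>s\<close> into
  \<open>s\<^sup>k = \<nabla>f(x\<^sup>k)\<close>, and compatibility of \<open>W\<close> with the graph turns the local exchange into
  \<open>y\<^sup>k = y\<^sup>k\<^sup>-\<^sup>1 + W s\<^sup>k\<close>, so \<open>y\<^sup>k = U\<^sup>T q\<^sup>k\<close>. Write \<open>H = \<beta> I - c W\<close>, let \<open>e\<close>, \<open>dx\<close> and \<open>a\<close> be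
  the errors of the gradients, of \<open>x\<close> and of \<open>q\<close> after the step, and let \<open>d\<close> be the change of the
  gradients during the step. The method then reads \<open>H d = - (dx + c U\<^sup>T a)\<close>, and the errors before
  the step are \<open>e - d\<close> and \<open>a - U e\<close>; the latter holds because the gradients of an optimal
  allocation agree across agents, hence are annihilated by \<open>U\<close>.

  Expanding with these relations the squared seminorm \<open>E\<close> of the error before the step, and writing
  \<open>E' = c \<parallel>a\<parallel>\<^sup>2 + \<langle>e, H e\<rangle>\<close> for the one after it, gives
  \<open>E = E' + c \<parallel>U e\<parallel>\<^sup>2 + \<langle>d, H d\<rangle> + 2 \<langle>e, dx\<rangle>\<close> (\<open>prox_step_energy_identity\<close>).
  The gain is at least a multiple of \<open>E'\<close>: strong convexity and cocoercivity of the gradients give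
  \<open>2 \<langle>e, dx\<rangle> \<ge> \<mu> \<parallel>dx\<parallel>\<^sup>2 + \<parallel>e\<parallel>\<^sup>2 / L\<close>; the \<open>e\<close> part of the energy is at most \<open>\<beta> \<parallel>e\<parallel>\<^sup>2\<close>; and the
  \<open>a\<close> part is controlled through \<open>c U\<^sup>T a = - (dx + H d)\<close> and
  \<open>\<parallel>U\<^sup>T a\<parallel>\<^sup>2 \<ge> \<lambda> \<parallel>a\<parallel>\<^sup>2\<close>, where \<open>\<lambda>\<close> is the smallest nonzero eigenvalue of \<open>W\<close>. So
  \<open>(1 + \<delta>) E' \<le> E\<close> as soon as \<open>\<delta>\<close> is at most \<open>c \<lambda> \<mu> / 2\<close>, \<open>c \<lambda> / (2 \<beta>)\<close> and
  \<open>1 / (L \<beta>)\<close> (\<open>prox_step_contraction\<close>, \<open>mirror_p_extra_energy_contraction\<close>).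

  With \<open>\<Lambda>\<close> the maximum of \<open>1\<close> and the largest eigenvalue of \<open>W\<close>, taking
  \<open>\<beta> = c \<Lambda>\<close> keeps \<open>H\<close> positive semidefinite, and \<open>c = 1 / sqrt (L \<mu> \<lambda> \<Lambda>)\<close> makes the
  first and the third bound on \<open>\<delta>\<close> proportional to each other.
  Then \<open>1 / \<delta>\<close> may be taken as \<open>3 \<Lambda> (1 / \<lambda> + sqrt (\<kappa> / \<lambda>))\<close> with \<open>\<kappa> = L / \<mu>\<close>
  (\<open>stepsize_choice\<close>), and \<open>2 / \<delta> \<cdot> ln (1 / \<epsilon>)\<close> steps reduce the energy by the factor \<open>\<epsilon>\<close>.

  The spectral input is that the smallest value of the Rayleigh quotient of a real symmetric matrix
  is an eigenvalue (\<open>symmetric_min_eigenvalue\<close>).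
\<close>

section \<open>Real vectors and symmetric matrices\<close>

lemma vec_eq_if_minus_zero:
  assumes "a \<in> carrier_vec n" "b \<in> carrier_vec n" "(a::real vec) - b = 0\<^sub>v n"
  shows "a = b"
proof (rule eq_vecI)
  fix i assume i: "i < dim_vec b"
  from arg_cong[OF assms(3), of "\<lambda>u. u $ i"]
  show "a $ i = b $ i" using assms(1,2) i by simp
qed (use assms in auto)

lemma add_zero_smult_vec:
  assumes "x \<in> carrier_vec n" "v \<in> carrier_vec n"
  shows "x + (0::real) \<cdot>\<^sub>v v = x"
proof (rule eq_vecI)
  fix i assume "i < dim_vec x"
  thus "(x + 0 \<cdot>\<^sub>v v) $ i = x $ i" using assms by simp
qed (use assms in simp)

lemma vec_norm2_squared: "(vec_norm2 v)\<^sup>2 = v \<bullet> v"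
  unfolding vec_norm2_def scalar_prod_def by (simp add: sum_nonneg)

lemma scalar_prod_self_nonneg: "(v::real vec) \<bullet> v \<ge> 0"
  unfolding scalar_prod_def by (simp add: sum_nonneg)

lemma vec_norm2_nonneg: "vec_norm2 v \<ge> 0"
  unfolding vec_norm2_def using scalar_prod_self_nonneg by simp

lemma scalar_prod_self_pos:
  assumes "v \<in> carrier_vec n" "v \<noteq> 0\<^sub>v n"
  shows "(v::real vec) \<bullet> v > 0"
proof (rule ccontr)
  assume "\<not> ?thesis"
  with scalar_prod_self_nonneg[of v] have "v \<bullet> v = 0" by linarith
  hence "\<forall>i\<in>{0..<dim_vec v}. v $ i * v $ i = 0"
    unfolding scalar_prod_def by (subst (asm) sum_nonneg_eq_0_iff) auto
  hence "v = 0\<^sub>v n" using assms(1) by (intro eq_vecI) auto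
  with assms(2) show False by simp
qed

lemma Cauchy_Schwarz_vec:
  assumes "u \<in> carrier_vec n" "v \<in> carrier_vec n"
  shows "((u::real vec) \<bullet> v)\<^sup>2 \<le> (u \<bullet> u) * (v \<bullet> v)"
proof (cases "v = 0\<^sub>v n")
  case False
  let ?w = "(v \<bullet> v) \<cdot>\<^sub>v u - (u \<bullet> v) \<cdot>\<^sub>v v"
  have "?w \<bullet> ?w = (v \<bullet> v) * ((u \<bullet> u) * (v \<bullet> v) - (u \<bullet> v)\<^sup>2)"
    using assms comm_scalar_prod[OF assms]
    by (simp add: minus_scalar_prod_distrib[of _ n] scalar_prod_minus_distrib[of _ n]
        algebra_simps power2_eq_square)
  with scalar_prod_self_nonneg[of ?w] scalar_prod_self_pos[OF assms(2) False]
  show ?thesis by (simp add: zero_le_mult_iff)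
qed (use assms in simp)

lemma Cauchy_Schwarz_norm2:
  assumes "u \<in> carrier_vec n" "v \<in> carrier_vec n"
  shows "u \<bullet> v \<le> vec_norm2 u * vec_norm2 v"
proof (rule power2_le_imp_le)
  show "(u \<bullet> v)\<^sup>2 \<le> (vec_norm2 u * vec_norm2 v)\<^sup>2"
    using Cauchy_Schwarz_vec[OF assms] by (simp add: power_mult_distrib vec_norm2_squared)
qed (simp add: vec_norm2_nonneg)

lemma scalar_prod_uminus_add_smult:
  assumes "e \<in> carrier_vec n" "x \<in> carrier_vec n" "y \<in> carrier_vec n"
  shows "(e::real vec) \<bullet> (- (x + c \<cdot>\<^sub>v y)) = - (e \<bullet> x) - c * (e \<bullet> y)"
proof -
  have "dim_vec e = dim_vec (x + c \<cdot>\<^sub>v y)" using assms by simp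
  hence "e \<bullet> (- (x + c \<cdot>\<^sub>v y)) = - (e \<bullet> (x + c \<cdot>\<^sub>v y))" by (rule scalar_prod_uminus_right)
  thus ?thesis using assms by (simp add: scalar_prod_add_distrib[of _ n])
qed

lemma uminus_add_smult_swap:
  assumes "u \<in> carrier_vec n" "x \<in> carrier_vec n" "y \<in> carrier_vec n"
    and eq: "u = - (x + c \<cdot>\<^sub>v y)"
  shows "c \<cdot>\<^sub>v y = - (x + (u :: real vec))"
  using assms(2,3) unfolding eq by (intro eq_vecI) auto

lemma sum_col_prod_eq_sum_row_prod:
  assumes "A \<in> carrier_mat n p" "B \<in> carrier_mat n p"
  shows "(\<Sum>l<p. col A l \<bullet> col B l) = (\<Sum>i<n. row A i \<bullet> (row B i :: real vec))"
  unfolding scalar_prod_def using assms by (simp add: lessThan_atLeast0) (rule sum.swap)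

lemma symmetric_bilinear:
  assumes "A \<in> carrier_mat n n" "A\<^sup>T = A" "v \<in> carrier_vec n" "w \<in> carrier_vec n"
  shows "(v::real vec) \<bullet> (A *\<^sub>v w) = w \<bullet> (A *\<^sub>v v)"
  using transpose_vec_mult_scalar[OF assms(1,4,3)] assms
  by (simp add: comm_scalar_prod[of _ n])

lemma smult_mat_mult_vec:
  assumes "(A::real mat) \<in> carrier_mat nr nc" "v \<in> carrier_vec nc"
  shows "(t \<cdot>\<^sub>m A) *\<^sub>v v = t \<cdot>\<^sub>v (A *\<^sub>v v)"
proof (rule eq_vecI)
  fix i assume "i < dim_vec (t \<cdot>\<^sub>v (A *\<^sub>v v))"
  thus "((t \<cdot>\<^sub>m A) *\<^sub>v v) $ i = (t \<cdot>\<^sub>v (A *\<^sub>v v)) $ i" using assms by simp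
qed simp

lemma mult_mat_vec_bounded:
  assumes "(A::real mat) \<in> carrier_mat n n"
  shows "\<exists>K>0. \<forall>v\<in>carrier_vec n. (A *\<^sub>v v) \<bullet> (A *\<^sub>v v) \<le> K * (v \<bullet> v)"
proof (intro exI conjI ballI)
  let ?K = "1 + (\<Sum>i<n. row A i \<bullet> row A i)"
  have s: "(\<Sum>i<n. row A i \<bullet> row A i) \<ge> 0" by (intro sum_nonneg scalar_prod_self_nonneg)
  thus "?K > 0" by linarith
  fix v :: "real vec" assume v: "v \<in> carrier_vec n"
  have "(A *\<^sub>v v) \<bullet> (A *\<^sub>v v) = (\<Sum>i<n. (row A i \<bullet> v)\<^sup>2)"
    using assms by (simp add: scalar_prod_def[of "A *\<^sub>v v"] power2_eq_square lessThan_atLeast0)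
  also have "\<dots> \<le> (\<Sum>i<n. (row A i \<bullet> row A i) * (v \<bullet> v))"
    using assms v by (intro sum_mono Cauchy_Schwarz_vec[of _ n]) auto
  also have "\<dots> \<le> ?K * (v \<bullet> v)"
    using scalar_prod_self_nonneg[of v] by (simp add: sum_distrib_right distrib_right)
  finally show "(A *\<^sub>v v) \<bullet> (A *\<^sub>v v) \<le> ?K * (v \<bullet> v)" .
qed

text \<open>
  The form is nonnegative at \<open>v - M v / K\<close>; expanding it there and bounding the quadratic term
  \<open>\<langle>M v, M (M v)\<rangle>\<close> by \<open>K \<parallel>M v\<parallel>\<^sup>2\<close> leaves the claim. It replaces the square root of \<open>M\<close> in the usual
  argument.
\<close>

lemma pos_semidef_image_bound:
  assumes M: "pos_semidef n M"
    and K: "K > 0" "\<And>v. v \<in> carrier_vec n \<Longrightarrow> v \<bullet> (M *\<^sub>v v) \<le> K * (v \<bullet> v)"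
    and v: "v \<in> carrier_vec n"
  shows "(M *\<^sub>v v) \<bullet> (M *\<^sub>v v) \<le> K * (v \<bullet> (M *\<^sub>v v))"
proof -
  have Mc: "M \<in> carrier_mat n n" and sym: "M\<^sup>T = M"
    and nn: "\<And>v. v \<in> carrier_vec n \<Longrightarrow> 0 \<le> v \<bullet> (M *\<^sub>v v)"
    using M by (auto simp: pos_semidef_def)
  define w where "w = M *\<^sub>v v"
  have w: "w \<in> carrier_vec n" using Mc v by (auto simp: w_def)
  have Mw: "M *\<^sub>v w \<in> carrier_vec n" using Mc w by auto
  have vMw: "v \<bullet> (M *\<^sub>v w) = w \<bullet> w"
    using symmetric_bilinear[OF Mc sym v w] by (simp add: w_def)
  let ?u = "v - (1/K) \<cdot>\<^sub>v w"
  have "M *\<^sub>v ?u = w - (1/K) \<cdot>\<^sub>v (M *\<^sub>v w)"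
    using Mc v w by (simp add: mult_minus_distrib_mat_vec[of _ n n] mult_mat_vec[of _ n n] w_def)
  hence "?u \<bullet> (M *\<^sub>v ?u) = v \<bullet> w - (1/K) * (v \<bullet> (M *\<^sub>v w)) - (1/K) * (w \<bullet> w)
      + (1/K) * ((1/K) * (w \<bullet> (M *\<^sub>v w)))"
    using v w Mw by (simp add: minus_scalar_prod_distrib[of _ n] scalar_prod_minus_distrib[of _ n] algebra_simps)
  moreover have "0 \<le> ?u \<bullet> (M *\<^sub>v ?u)" using v w by (intro nn) auto
  moreover have "(1/K) * ((1/K) * (w \<bullet> (M *\<^sub>v w))) \<le> (1/K) * (w \<bullet> w)"
    using K(2)[OF w] K(1) by (simp add: field_simps)
  ultimately have "0 \<le> v \<bullet> w - (1/K) * (w \<bullet> w)" using vMw by simp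
  thus ?thesis using K(1) by (simp add: w_def field_simps)
qed

section \<open>Extreme eigenvalues of symmetric matrices\<close>

lemma shift_mult_mat_vec:
  assumes "(A::real mat) \<in> carrier_mat n n" "v \<in> carrier_vec n"
  shows "(A - t \<cdot>\<^sub>m 1\<^sub>m n) *\<^sub>v v = A *\<^sub>v v - t \<cdot>\<^sub>v v"
proof -
  have "(t \<cdot>\<^sub>m 1\<^sub>m n) *\<^sub>v v = t \<cdot>\<^sub>v v"
    using smult_mat_mult_vec[of "1\<^sub>m n" n n v t] assms(2) by simp
  thus ?thesis using minus_mult_distrib_mat_vec[OF assms(1) _ assms(2), of "t \<cdot>\<^sub>m 1\<^sub>m n"] by simp
qed

lemma eigenvalue_shift_invertible:
  assumes A: "(A::real mat) \<in> carrier_mat n n" and "\<not> eigenvalue A t"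
  shows "\<exists>B\<in>carrier_mat n n. B * (A - t \<cdot>\<^sub>m 1\<^sub>m n) = 1\<^sub>m n"
proof -
  let ?M = "A - t \<cdot>\<^sub>m 1\<^sub>m n"
  have M: "?M \<in> carrier_mat n n" using A by auto
  have "det ?M \<noteq> 0"
  proof
    assume "det ?M = 0"
    then obtain v where v: "v \<in> carrier_vec n" "v \<noteq> 0\<^sub>v n" "?M *\<^sub>v v = 0\<^sub>v n"
      using det_0_iff_vec_prod_zero_field[OF M] by auto
    have "?M *\<^sub>v v = A *\<^sub>v v - t \<cdot>\<^sub>v v" by (rule shift_mult_mat_vec[OF A v(1)])
    hence "A *\<^sub>v v - t \<cdot>\<^sub>v v = 0\<^sub>v n" using v by simp
    moreover have "A *\<^sub>v v \<in> carrier_vec n" "t \<cdot>\<^sub>v v \<in> carrier_vec n" using A v(1) by auto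
    ultimately have "A *\<^sub>v v = t \<cdot>\<^sub>v v" by (metis vec_eq_if_minus_zero)
    thus False using assms v A unfolding eigenvalue_def eigenvector_def by auto
  qed
  from det_non_zero_imp_unit[OF M this] show ?thesis
    unfolding Units_def ring_mat_def by auto
qed

text \<open>
  Let \<open>t\<close> be the infimum of the Rayleigh quotient, so that \<open>A - t I\<close> is positive semidefinite. If \<open>t\<close>
  were not an eigenvalue, \<open>A - t I\<close> would have a bounded inverse, whence
  \<open>\<parallel>v\<parallel>\<^sup>2 \<le> K\<^sub>1 \<parallel>(A - t I) v\<parallel>\<^sup>2 \<le> K\<^sub>1 K\<^sub>2 \<langle>v, (A - t I) v\<rangle>\<close>, and \<open>t\<close> plus the positive constant
  \<open>1 / (K\<^sub>1 K\<^sub>2)\<close> would still be a lower bound.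
\<close>

lemma symmetric_min_eigenvalue:
  assumes A: "(A::real mat) \<in> carrier_mat n n" and sym: "A\<^sup>T = A" and n: "n > 0"
  shows "\<exists>t. eigenvalue A t \<and> (\<forall>v\<in>carrier_vec n. t * (v \<bullet> v) \<le> v \<bullet> (A *\<^sub>v v))"
proof -
  define S where "S = {(v \<bullet> (A *\<^sub>v v)) / (v \<bullet> v) | v. v \<in> carrier_vec n \<and> v \<noteq> 0\<^sub>v n}"
  obtain K where K: "K > 0" "\<And>v. v \<in> carrier_vec n \<Longrightarrow> (A *\<^sub>v v) \<bullet> (A *\<^sub>v v) \<le> K * (v \<bullet> v)"
    using mult_mat_vec_bounded[OF A] by auto
  have low: "- (1 + K) * (v \<bullet> v) \<le> v \<bullet> (A *\<^sub>v v)" and up: "v \<bullet> (A *\<^sub>v v) \<le> (1 + K) * (v \<bullet> v)"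
    if v: "v \<in> carrier_vec n" for v
  proof -
    have Av: "A *\<^sub>v v \<in> carrier_vec n" using A v by auto
    have "0 \<le> (v + A *\<^sub>v v) \<bullet> (v + A *\<^sub>v v)" "0 \<le> (v - A *\<^sub>v v) \<bullet> (v - A *\<^sub>v v)"
      by (rule scalar_prod_self_nonneg)+
    hence "- 2 * (v \<bullet> (A *\<^sub>v v)) \<le> v \<bullet> v + (A *\<^sub>v v) \<bullet> (A *\<^sub>v v)"
      "2 * (v \<bullet> (A *\<^sub>v v)) \<le> v \<bullet> v + (A *\<^sub>v v) \<bullet> (A *\<^sub>v v)"
      using v Av comm_scalar_prod[OF v Av]
      by (simp_all add: minus_scalar_prod_distrib[of _ n] scalar_prod_minus_distrib[of _ n]
        add_scalar_prod_distrib[of _ n] scalar_prod_add_distrib[of _ n])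
    moreover have "0 \<le> K * (v \<bullet> v)" using K(1) scalar_prod_self_nonneg[of v] by simp
    ultimately show "- (1 + K) * (v \<bullet> v) \<le> v \<bullet> (A *\<^sub>v v)" "v \<bullet> (A *\<^sub>v v) \<le> (1 + K) * (v \<bullet> v)"
      using K(2)[OF v] scalar_prod_self_nonneg[of v] by (simp_all add: distrib_right left_diff_distrib)
  qed
  have Slow: "- (1 + K) \<le> a" if a: "a \<in> S" for a
  proof -
    obtain v where v: "v \<in> carrier_vec n" "v \<noteq> 0\<^sub>v n" "a = (v \<bullet> (A *\<^sub>v v)) / (v \<bullet> v)"
      using a by (auto simp: S_def)
    show ?thesis using low[OF v(1)] scalar_prod_self_pos[OF v(1,2)] unfolding v(3)
      by (subst pos_le_divide_eq) auto
  qed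
  have "unit_vec n 0 \<noteq> (0\<^sub>v n :: real vec)"
    using n by (metis index_unit_vec(1) index_zero_vec(1) zero_neq_one)
  hence Sne: "S \<noteq> {}" unfolding S_def using unit_vec_carrier by blast
  have bdd: "bdd_below S" using Slow by (rule bdd_belowI)
  define t where "t = Inf S"
  have t: "t * (v \<bullet> v) \<le> v \<bullet> (A *\<^sub>v v)" if v: "v \<in> carrier_vec n" for v
  proof (cases "v = 0\<^sub>v n")
    case False
    hence "t \<le> (v \<bullet> (A *\<^sub>v v)) / (v \<bullet> v)"
      unfolding t_def using v by (intro cInf_lower bdd) (auto simp: S_def)
    thus ?thesis using scalar_prod_self_pos[OF v False] by (simp add: pos_le_divide_eq)
  qed (use A in auto)
  have "eigenvalue A t"
  proof (rule ccontr)
    let ?M = "A - t \<cdot>\<^sub>m 1\<^sub>m n"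
    assume "\<not> eigenvalue A t"
    then obtain B where B: "B \<in> carrier_mat n n" and BM: "B * ?M = 1\<^sub>m n"
      using eigenvalue_shift_invertible[OF A] by auto
    have M: "?M \<in> carrier_mat n n" using A by auto
    have qM: "v \<bullet> (?M *\<^sub>v v) = v \<bullet> (A *\<^sub>v v) - t * (v \<bullet> v)" if v: "v \<in> carrier_vec n" for v
      using A v by (simp add: shift_mult_mat_vec scalar_prod_minus_distrib[of _ n])
    have "(t \<cdot>\<^sub>m 1\<^sub>m n)\<^sup>T = t \<cdot>\<^sub>m (1\<^sub>m n :: real mat)" by (intro eq_matI) auto
    hence "?M\<^sup>T = ?M" using A sym by (simp add: transpose_minus[of _ n n])
    hence psd: "pos_semidef n ?M" using M t qM by (simp add: pos_semidef_def)
    obtain K1 where K1: "K1 > 0" "\<And>v. v \<in> carrier_vec n \<Longrightarrow> (B *\<^sub>v v) \<bullet> (B *\<^sub>v v) \<le> K1 * (v \<bullet> v)"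
      using mult_mat_vec_bounded[OF B] by auto
    define K2 where "K2 = 1 + K + \<bar>t\<bar>"
    have K2: "K2 > 0" using K(1) by (simp add: K2_def)
    have K2M: "v \<bullet> (?M *\<^sub>v v) \<le> K2 * (v \<bullet> v)" if v: "v \<in> carrier_vec n" for v
    proof -
      have "- t * (v \<bullet> v) \<le> \<bar>t\<bar> * (v \<bullet> v)"
        using scalar_prod_self_nonneg[of v] by (intro mult_right_mono) auto
      thus ?thesis using up[OF v] qM[OF v] by (simp add: K2_def distrib_right)
    qed
    \<comment> \<open>The uniform gap that invertibility of the shifted matrix would create.\<close>
    have gap: "v \<bullet> v \<le> (K1 * K2) * (v \<bullet> (?M *\<^sub>v v))" if v: "v \<in> carrier_vec n" for v
    proof -
      have "v = B *\<^sub>v (?M *\<^sub>v v)"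
        using B M v BM by (metis assoc_mult_mat_vec one_mult_mat_vec)
      hence "v \<bullet> v \<le> K1 * ((?M *\<^sub>v v) \<bullet> (?M *\<^sub>v v))"
        using K1(2)[of "?M *\<^sub>v v"] M v by auto
      also have "\<dots> \<le> K1 * (K2 * (v \<bullet> (?M *\<^sub>v v)))"
        using K1(1) pos_semidef_image_bound[OF psd K2 K2M v] by (intro mult_left_mono) auto
      finally show ?thesis by simp
    qed
    have "t + 1 / (K1 * K2) \<le> Inf S"
    proof (rule cInf_greatest[OF Sne])
      fix a assume "a \<in> S"
      then obtain v where v: "v \<in> carrier_vec n" "v \<noteq> 0\<^sub>v n" "a = (v \<bullet> (A *\<^sub>v v)) / (v \<bullet> v)"
        by (auto simp: S_def)
      have "(v \<bullet> v) / (K1 * K2) \<le> v \<bullet> (A *\<^sub>v v) - t * (v \<bullet> v)"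
        using gap[OF v(1)] K1(1) K2 qM[OF v(1)] by (simp add: pos_divide_le_eq mult.commute)
      thus "t + 1 / (K1 * K2) \<le> a"
        using scalar_prod_self_pos[OF v(1,2)] by (simp add: v(3) pos_le_divide_eq distrib_right)
    qed
    moreover have "1 / (K1 * K2) > 0" using K1(1) K2 by simp
    ultimately show False by (simp add: t_def)
  qed
  thus ?thesis using t by blast
qed

lemma eigenvalue_rayleigh:
  assumes "(A::real mat) \<in> carrier_mat n n" "eigenvalue A l"
  obtains v where "v \<in> carrier_vec n" "v \<bullet> v > 0" "A *\<^sub>v v = l \<cdot>\<^sub>v v"
proof -
  obtain v where "v \<in> carrier_vec n" "v \<noteq> 0\<^sub>v n" "A *\<^sub>v v = l \<cdot>\<^sub>v v"
    using assms unfolding eigenvalue_def eigenvector_def by auto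
  thus thesis using that scalar_prod_self_pos by metis
qed

lemma finite_eigenvalues:
  assumes "(A::real mat) \<in> carrier_mat n n"
  shows "finite {l. eigenvalue A l}"
proof -
  have "char_poly A \<noteq> 0" using degree_monic_char_poly[OF assms] by auto
  thus ?thesis using poly_roots_finite by (simp add: eigenvalue_root_char_poly[OF assms])
qed

text \<open>
  The smallest eigenvalue of \<open>- A\<close> is minus an eigenvalue of \<open>A\<close>.
\<close>

lemma symmetric_max_eigenvalue:
  assumes A: "(A::real mat) \<in> carrier_mat n n" and sym: "A\<^sup>T = A" and v: "v \<in> carrier_vec n"
  shows "v \<bullet> (A *\<^sub>v v) \<le> max_eigenvalue A * (v \<bullet> v)"
proof (cases "n = 0")
  case True
  thus ?thesis using v A by (simp add: scalar_prod_def)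
next
  case False
  have neg: "(- A) *\<^sub>v w = - (A *\<^sub>v w)" if "w \<in> carrier_vec n" for w
    using A that by (intro eq_vecI) auto
  obtain t where t: "eigenvalue (- A) t" "\<And>v. v \<in> carrier_vec n \<Longrightarrow> t * (v \<bullet> v) \<le> v \<bullet> ((- A) *\<^sub>v v)"
    using symmetric_min_eigenvalue[of "- A" n] A sym False by (auto simp: transpose_uminus)
  from eigenvalue_rayleigh[OF _ t(1), of n] A obtain w
    where w: "w \<in> carrier_vec n" "w \<bullet> w > 0" "(- A) *\<^sub>v w = t \<cdot>\<^sub>v w" by auto
  have "A *\<^sub>v w = (- t) \<cdot>\<^sub>v w"
  proof (rule eq_vecI)
    fix i assume i: "i < dim_vec (- t \<cdot>\<^sub>v w)"
    have "- (A *\<^sub>v w) = t \<cdot>\<^sub>v w" using w(1,3) neg by simp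
    from arg_cong[OF this, of "\<lambda>u. u $ i"]
    show "(A *\<^sub>v w) $ i = (- t \<cdot>\<^sub>v w) $ i" using i w(1) A by simp
  qed (use A w in auto)
  hence "eigenvalue A (- t)" using w A unfolding eigenvalue_def eigenvector_def by auto
  hence "- t \<le> max_eigenvalue A"
    unfolding max_eigenvalue_def using finite_eigenvalues[OF A] by (intro Max_ge) auto
  hence "- t * (v \<bullet> v) \<le> max_eigenvalue A * (v \<bullet> v)"
    by (intro mult_right_mono scalar_prod_self_nonneg)
  moreover have "v \<bullet> ((- A) *\<^sub>v v) = - (v \<bullet> (A *\<^sub>v v))" using A v by (simp add: neg)
  ultimately show ?thesis using t(2)[OF v] by simp
qed

text \<open>
  Full row rank provides \<open>m\<close> independent columns of \<open>U\<close>, which form an invertible square matrix; the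
  equations of \<open>U\<^sup>T v = 0\<close> that belong to these columns already force \<open>v = 0\<close>.
\<close>

lemma full_row_rank_transpose_inj:
  assumes U: "(U::real mat) \<in> carrier_mat m n" and rank: "vec_space.rank m U = m"
    and v: "v \<in> carrier_vec m" and zero: "U\<^sup>T *\<^sub>v v = 0\<^sub>v n"
  shows "v = 0\<^sub>v m"
proof -
  interpret vec_space "TYPE(real)" m .
  have cols: "set (cols U) \<subseteq> carrier_vec m" using U cols_dim by blast
  obtain S where S: "finite S" "maximal S (\<lambda>T. T \<subseteq> set (cols U) \<and> lin_indpt T)"
    using maximal_exists_superset[of "set (cols U)" "\<lambda>T. T \<subseteq> set (cols U) \<and> lin_indpt T" "{}"]
      finite_lin_indpt2 by auto
  hence Scols: "S \<subseteq> set (cols U)" and li: "lin_indpt S" by (auto simp: maximal_def)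
  have "card S = m" using rank_card_indpt[OF U S(2)] rank by simp
  obtain ss where ss: "set ss = S" "distinct ss" using finite_distinct_list[OF S(1)] by auto
  have len: "length ss = m" using ss \<open>card S = m\<close> distinct_card by fastforce
  define M where "M = mat_of_cols m ss"
  have M: "M \<in> carrier_mat m m" using len by (auto simp: M_def)
  have cM: "cols M = ss" unfolding M_def using ss Scols cols by (intro cols_mat_of_cols) auto
  have "rank M = m" using lin_indpt_full_rank[OF M] cM ss li by auto
  hence "det (M\<^sup>T) \<noteq> 0" using det_rank_iff[OF M] det_transpose[OF M] by simp
  moreover have "M\<^sup>T *\<^sub>v v = 0\<^sub>v m"
  proof (rule eq_vecI)
    fix i assume "i < dim_vec (0\<^sub>v m :: real vec)"
    hence i: "i < m" by simp
    have "col M i = ss ! i" using cM M i by (metis carrier_matD(2) cols_nth)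
    hence "col M i \<in> set (cols U)" using ss Scols len i by auto
    then obtain j where j: "j < n" "col M i = col U j" using U by (auto simp: cols_def)
    have "col U j \<bullet> v = 0"
      using arg_cong[OF zero, of "\<lambda>w. w $ j"] j U by simp
    thus "(M\<^sup>T *\<^sub>v v) $ i = 0\<^sub>v m $ i" using M i j by simp
  qed (use M in auto)
  ultimately show ?thesis using det_0_iff_vec_prod_zero_field[of "M\<^sup>T" m] M v by auto
qed

text \<open>
  \<open>U U\<^sup>T\<close> and \<open>U\<^sup>T U\<close> have the same nonzero eigenvalues: \<open>U\<^sup>T\<close> maps eigenvectors of the former to
  eigenvectors of the latter. Since \<open>U\<^sup>T\<close> is injective, the smallest eigenvalue \<open>t\<close> of \<open>U U\<^sup>T\<close> is
  positive, so it is one of the nonzero eigenvalues of \<open>W\<close>, and \<open>\<parallel>U\<^sup>T v\<parallel>\<^sup>2 = \<langle>v, U U\<^sup>T v\<rangle> \<ge> t \<parallel>v\<parallel>\<^sup>2\<close>.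
\<close>

lemma nonzero_spectrum_gram:
  assumes U: "(U::real mat) \<in> carrier_mat m n" and m: "m > 0" and rank: "vec_space.rank m U = m"
  defines "W \<equiv> U\<^sup>T * U"
  shows "min_nonzero_eigenvalue W > 0" "min_nonzero_eigenvalue W \<le> max_eigenvalue W"
    "\<And>v. v \<in> carrier_vec m \<Longrightarrow>
       min_nonzero_eigenvalue W * (v \<bullet> v) \<le> (U\<^sup>T *\<^sub>v v) \<bullet> (U\<^sup>T *\<^sub>v v)"
proof -
  have W: "W \<in> carrier_mat n n" using U by (simp add: W_def)
  have qW: "v \<bullet> (W *\<^sub>v v) = (U *\<^sub>v v) \<bullet> (U *\<^sub>v v)" if v: "v \<in> carrier_vec n" for v
  proof -
    have "W *\<^sub>v v = U\<^sup>T *\<^sub>v (U *\<^sub>v v)" using U v by (simp add: W_def)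
    thus ?thesis using transpose_vec_mult_scalar[OF U v, of "U *\<^sub>v v"] U v
      by (simp add: comm_scalar_prod[of _ n])
  qed
  let ?A = "U * U\<^sup>T"
  have A: "?A \<in> carrier_mat m m" using U by simp
  have qA: "v \<bullet> (?A *\<^sub>v v) = (U\<^sup>T *\<^sub>v v) \<bullet> (U\<^sup>T *\<^sub>v v)" if v: "v \<in> carrier_vec m" for v
  proof -
    have "?A *\<^sub>v v = U *\<^sub>v (U\<^sup>T *\<^sub>v v)" using U v by simp
    thus ?thesis using transpose_vec_mult_scalar[OF U _ v, of "U\<^sup>T *\<^sub>v v"] U v by simp
  qed
  have "?A\<^sup>T = ?A" using U by (simp add: transpose_mult[of _ m n _ m])
  then obtain t where t: "eigenvalue ?A t" "\<And>v. v \<in> carrier_vec m \<Longrightarrow> t * (v \<bullet> v) \<le> v \<bullet> (?A *\<^sub>v v)"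
    using symmetric_min_eigenvalue[OF A _ m] by auto
  obtain v where v: "v \<in> carrier_vec m" "v \<bullet> v > 0" "?A *\<^sub>v v = t \<cdot>\<^sub>v v"
    using eigenvalue_rayleigh[OF A t(1)] by metis
  have Uv: "U\<^sup>T *\<^sub>v v \<in> carrier_vec n" using U v by auto
  have Uv0: "U\<^sup>T *\<^sub>v v \<noteq> 0\<^sub>v n"
    using full_row_rank_transpose_inj[OF U rank v(1)] v(2) by auto
  have "t * (v \<bullet> v) = (U\<^sup>T *\<^sub>v v) \<bullet> (U\<^sup>T *\<^sub>v v)" using qA[OF v(1)] v by simp
  hence t0: "t > 0" using scalar_prod_self_pos[OF Uv Uv0] v(2) by (metis zero_less_mult_pos2)
  have "W *\<^sub>v (U\<^sup>T *\<^sub>v v) = U\<^sup>T *\<^sub>v (?A *\<^sub>v v)"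
    using U v Uv by (simp add: W_def)
  also have "\<dots> = t \<cdot>\<^sub>v (U\<^sup>T *\<^sub>v v)" using v mult_mat_vec[of "U\<^sup>T" n m v t] U by simp
  finally have tW: "eigenvalue W t"
    using Uv Uv0 W unfolding eigenvalue_def eigenvector_def by auto
  let ?S = "{l. eigenvalue W l \<and> l \<noteq> 0}"
  have fin: "finite ?S" using finite_eigenvalues[OF W] by simp
  have tS: "t \<in> ?S" using tW t0 by simp
  have le: "min_nonzero_eigenvalue W \<le> t"
    unfolding min_nonzero_eigenvalue_def by (rule Min_le[OF fin tS])
  have mem: "min_nonzero_eigenvalue W \<in> ?S"
    unfolding min_nonzero_eigenvalue_def using fin tS by (intro Min_in) auto
  have "l \<ge> 0" if l: "eigenvalue W l" for l
  proof -
    obtain w where w: "w \<in> carrier_vec n" "w \<bullet> w > 0" "W *\<^sub>v w = l \<cdot>\<^sub>v w"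
      using eigenvalue_rayleigh[OF W l] by metis
    have "l * (w \<bullet> w) = (U *\<^sub>v w) \<bullet> (U *\<^sub>v w)" using qW[OF w(1)] w by simp
    thus ?thesis using scalar_prod_self_nonneg[of "U *\<^sub>v w"] w(2)
      by (metis mult_neg_pos not_less)
  qed
  thus "min_nonzero_eigenvalue W > 0" using mem by force
  show "min_nonzero_eigenvalue W \<le> max_eigenvalue W"
    unfolding max_eigenvalue_def using mem finite_eigenvalues[OF W] by (intro Max_ge) auto
  fix u :: "real vec" assume u: "u \<in> carrier_vec m"
  have "min_nonzero_eigenvalue W * (u \<bullet> u) \<le> t * (u \<bullet> u)"
    using le by (rule mult_right_mono) (rule scalar_prod_self_nonneg)
  also have "\<dots> \<le> (U\<^sup>T *\<^sub>v u) \<bullet> (U\<^sup>T *\<^sub>v u)" using t(2)[OF u] qA[OF u] by simp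
  finally show "min_nonzero_eigenvalue W * (u \<bullet> u) \<le> (U\<^sup>T *\<^sub>v u) \<bullet> (U\<^sup>T *\<^sub>v u)" .
qed

text \<open>
  The first part makes the metric positive semidefinite; the second bounds the energy of a gradient
  error by its norm.
\<close>

lemma scaled_identity_minus_psd:
  assumes W: "(W::real mat) \<in> carrier_mat n n" "W\<^sup>T = W"
    and W0: "\<And>v. v \<in> carrier_vec n \<Longrightarrow> 0 \<le> v \<bullet> (W *\<^sub>v v)"
    and W1: "\<And>v. v \<in> carrier_vec n \<Longrightarrow> v \<bullet> (W *\<^sub>v v) \<le> K * (v \<bullet> v)"
    and c: "c > 0" and \<beta>: "c * K \<le> \<beta>"
  shows "pos_semidef n (mat_diag n (\<lambda>_. \<beta>) - c \<cdot>\<^sub>m W)" (is "pos_semidef n ?H")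
    and "v \<in> carrier_vec n \<Longrightarrow> v \<bullet> ((mat_diag n (\<lambda>_. \<beta>) - c \<cdot>\<^sub>m W) *\<^sub>v v) \<le> \<beta> * (v \<bullet> v)"
proof -
  have form: "v \<bullet> (?H *\<^sub>v v) = \<beta> * (v \<bullet> v) - c * (v \<bullet> (W *\<^sub>v v))" if v: "v \<in> carrier_vec n" for v
  proof -
    have Wv: "W *\<^sub>v v \<in> carrier_vec n" using W v by auto
    have "mat_diag n (\<lambda>_. \<beta>) = \<beta> \<cdot>\<^sub>m 1\<^sub>m n" by (intro eq_matI) (auto simp: mat_diag_def)
    hence "mat_diag n (\<lambda>_. \<beta>) *\<^sub>v v = \<beta> \<cdot>\<^sub>v v"
      using smult_mat_mult_vec[of "1\<^sub>m n" n n v \<beta>] v by simp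
    hence "?H *\<^sub>v v = \<beta> \<cdot>\<^sub>v v - c \<cdot>\<^sub>v (W *\<^sub>v v)"
      using minus_mult_distrib_mat_vec[OF _ _ v, of "mat_diag n (\<lambda>_. \<beta>)" n "c \<cdot>\<^sub>m W"]
        smult_mat_mult_vec[OF W(1) v, of c] W by simp
    thus ?thesis using v Wv by (simp add: scalar_prod_minus_distrib[of _ n])
  qed
  have "c * (v \<bullet> (W *\<^sub>v v)) \<le> \<beta> * (v \<bullet> v)" if v: "v \<in> carrier_vec n" for v
  proof -
    have "c * (v \<bullet> (W *\<^sub>v v)) \<le> c * (K * (v \<bullet> v))" using W1[OF v] c by simp
    also have "\<dots> \<le> \<beta> * (v \<bullet> v)"
      using mult_right_mono[OF \<beta> scalar_prod_self_nonneg[of v]] by (simp add: mult.assoc)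
    finally show ?thesis .
  qed
  moreover have "?H\<^sup>T = ?H"
  proof (rule eq_matI)
    fix i j assume "i < dim_row ?H" "j < dim_col ?H"
    hence ij: "i < n" "j < n" using W by auto
    have "W $$ (j, i) = W $$ (i, j)" using arg_cong[OF W(2), of "\<lambda>A. A $$ (i, j)"] W(1) ij by simp
    thus "?H\<^sup>T $$ (i, j) = ?H $$ (i, j)" using W(1) ij by (auto simp: mat_diag_def)
  qed (use W in auto)
  ultimately show "pos_semidef n ?H" using form W(1) by (auto simp: pos_semidef_def)
  show "v \<bullet> (?H *\<^sub>v v) \<le> \<beta> * (v \<bullet> v)" if v: "v \<in> carrier_vec n"
    using form[OF v] W0[OF v] c by simp
qed

section \<open>Gradients of smooth strongly convex functions\<close>

lemma has_gradientD:
  assumes "has_gradient p f g x" "e > 0"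
  shows "\<exists>d>0. \<forall>y\<in>carrier_vec p. vec_norm2 (y - x) < d \<longrightarrow>
     \<bar>f y - f x - g \<bullet> (y - x)\<bar> \<le> e * vec_norm2 (y - x)"
  using assms by (simp add: has_gradient_def)

text \<open>
  Along the direction \<open>w = g - g'\<close> the two linear approximations differ by \<open>t \<parallel>w\<parallel>\<^sup>2\<close> at distance
  \<open>t \<parallel>w\<parallel>\<close>, which exceeds the two permitted errors together when the tolerance is \<open>\<parallel>w\<parallel> / 3\<close>.
\<close>

lemma has_gradient_unique:
  assumes "has_gradient p f g x" "has_gradient p f g' x" and x: "x \<in> carrier_vec p"
  shows "g = g'"
proof (rule ccontr)
  assume ne: "g \<noteq> g'"
  have g: "g \<in> carrier_vec p" "g' \<in> carrier_vec p" using assms by (auto simp: has_gradient_def)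
  define w where "w = g - g'"
  have w: "w \<in> carrier_vec p" using g by (simp add: w_def)
  have "w \<noteq> 0\<^sub>v p" using ne vec_eq_if_minus_zero[OF g] by (auto simp: w_def)
  hence ww: "w \<bullet> w > 0" by (rule scalar_prod_self_pos[OF w])
  define N where "N = vec_norm2 w"
  have N: "N > 0" "N * N = w \<bullet> w" using ww vec_norm2_squared[of w]
    by (auto simp: N_def vec_norm2_def power2_eq_square)
  obtain d1 where d1: "d1 > 0" "\<And>y. y \<in> carrier_vec p \<Longrightarrow> vec_norm2 (y - x) < d1 \<Longrightarrow>
     \<bar>f y - f x - g \<bullet> (y - x)\<bar> \<le> N / 3 * vec_norm2 (y - x)"
    using has_gradientD[OF assms(1), of "N / 3"] N(1) by auto
  obtain d2 where d2: "d2 > 0" "\<And>y. y \<in> carrier_vec p \<Longrightarrow> vec_norm2 (y - x) < d2 \<Longrightarrow>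
     \<bar>f y - f x - g' \<bullet> (y - x)\<bar> \<le> N / 3 * vec_norm2 (y - x)"
    using has_gradientD[OF assms(2), of "N / 3"] N(1) by auto
  \<comment> \<open>Half of the smaller radius, so that the point \<open>y\<close> lies strictly inside both balls.\<close>
  define t where "t = min d1 d2 / (2 * N)"
  have t: "t > 0" using d1 d2 N by (simp add: t_def)
  define y where "y = x + t \<cdot>\<^sub>v w"
  have y: "y \<in> carrier_vec p" and yx: "y - x = t \<cdot>\<^sub>v w"
    using x w by (auto simp: y_def)
  have ny: "vec_norm2 (y - x) = t * N"
    using t w by (simp add: yx vec_norm2_def N_def real_sqrt_mult)
  have "t * N < d1" "t * N < d2" using N d1(1) d2(1) by (auto simp: t_def)
  hence "\<bar>f y - f x - g \<bullet> (y - x)\<bar> \<le> N / 3 * (t * N)" "\<bar>f y - f x - g' \<bullet> (y - x)\<bar> \<le> N / 3 * (t * N)"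
    using d1(2)[OF y] d2(2)[OF y] ny by auto
  moreover have "g \<bullet> (y - x) - g' \<bullet> (y - x) = t * (N * N)"
    using w g by (simp add: yx N(2) w_def minus_scalar_prod_distrib[of _ p] scalar_prod_minus_distrib[of _ p] algebra_simps)
  ultimately have "t * (N * N) \<le> 2 * (N / 3 * (t * N))" by linarith
  moreover have "t * (N * N) > 0" using t N(1) by simp
  ultimately show False by (simp add: algebra_simps)
qed

lemma has_gradient_grad:
  assumes "differentiable_vec p f" "x \<in> carrier_vec p"
  shows "has_gradient p f (grad p f x) x"
proof -
  obtain g where g: "has_gradient p f g x" using assms by (auto simp: differentiable_vec_def)
  show ?thesis unfolding grad_def
    using g by (rule theI) (rule has_gradient_unique[OF _ g assms(2)])
qed

lemma grad_carrier:
  assumes "differentiable_vec p f" "x \<in> carrier_vec p"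
  shows "grad p f x \<in> carrier_vec p"
  using has_gradient_grad[OF assms] by (simp add: has_gradient_def)

lemma has_gradient_line_deriv:
  assumes "has_gradient p f g x" and x: "x \<in> carrier_vec p" and v: "v \<in> carrier_vec p"
  shows "((\<lambda>t. f (x + t \<cdot>\<^sub>v v)) has_real_derivative g \<bullet> v) (at 0)"
proof -
  have g: "g \<in> carrier_vec p" using assms by (auto simp: has_gradient_def)
  have x0: "x + 0 \<cdot>\<^sub>v v = x" by (rule add_zero_smult_vec[OF x v])
  have "(\<lambda>h. (f (x + (0 + h) \<cdot>\<^sub>v v) - f (x + 0 \<cdot>\<^sub>v v)) / h) \<midarrow>0\<rightarrow> g \<bullet> v"
  proof (rule LIM_I)
    fix e :: real assume e: "e > 0"
    define N where "N = vec_norm2 v"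
    have N: "N \<ge> 0" by (simp add: N_def vec_norm2_nonneg)
    \<comment> \<open>Dividing by \<open>N + 1\<close> instead of \<open>N\<close> covers the direction \<open>v = 0\<close>.\<close>
    obtain d where d: "d > 0" "\<And>y. y \<in> carrier_vec p \<Longrightarrow> vec_norm2 (y - x) < d \<Longrightarrow>
        \<bar>f y - f x - g \<bullet> (y - x)\<bar> \<le> e / (N + 1) * vec_norm2 (y - x)"
      using has_gradientD[OF assms(1), of "e / (N + 1)"] e N by auto
    show "\<exists>s>0. \<forall>h. h \<noteq> 0 \<and> norm (h - 0) < s \<longrightarrow>
        norm ((f (x + (0 + h) \<cdot>\<^sub>v v) - f (x + 0 \<cdot>\<^sub>v v)) / h - g \<bullet> v) < e"
    proof (intro exI conjI allI impI)
      show "d / (N + 1) > 0" using d N by simp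
      fix h :: real assume h: "h \<noteq> 0 \<and> norm (h - 0) < d / (N + 1)"
      let ?y = "x + h \<cdot>\<^sub>v v"
      have y: "?y \<in> carrier_vec p" and yx: "?y - x = h \<cdot>\<^sub>v v" using x v by auto
      have ny: "vec_norm2 (?y - x) = \<bar>h\<bar> * N"
        unfolding yx using v by (simp add: vec_norm2_def N_def real_sqrt_mult mult.assoc[symmetric])
      have "\<bar>h\<bar> * (N + 1) < d" using h N by (simp add: pos_less_divide_eq)
      hence "\<bar>h\<bar> * N < d" by (simp add: distrib_left)
      hence "\<bar>f ?y - f x - g \<bullet> (?y - x)\<bar> \<le> e / (N + 1) * (\<bar>h\<bar> * N)" using d(2)[OF y] ny by simp
      hence "\<bar>f ?y - f x - h * (g \<bullet> v)\<bar> \<le> e / (N + 1) * (\<bar>h\<bar> * N)"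
        using g v by (simp add: yx)
      moreover have "(f ?y - f x) / h - g \<bullet> v = (f ?y - f x - h * (g \<bullet> v)) / h"
        using h by (simp add: diff_divide_distrib)
      ultimately have "\<bar>(f ?y - f x) / h - g \<bullet> v\<bar> \<le> e / (N + 1) * N"
        using h by (simp add: pos_divide_le_eq mult_ac)
      also have "\<dots> < e" using e N by (simp add: pos_divide_less_eq)
      finally show "norm ((f (x + (0 + h) \<cdot>\<^sub>v v) - f (x + 0 \<cdot>\<^sub>v v)) / h - g \<bullet> v) < e"
        using x0 by simp
    qed
  qed
  thus ?thesis by (simp add: DERIV_def)
qed

text \<open>
  Reduces one-variable calculus along \<open>x + t v\<close> to the gradient at the current point.
\<close>

lemma line_deriv:
  assumes f: "differentiable_vec p f" and x: "x \<in> carrier_vec p" and v: "v \<in> carrier_vec p"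
  shows "((\<lambda>t. f (x + t \<cdot>\<^sub>v v)) has_real_derivative grad p f (x + t \<cdot>\<^sub>v v) \<bullet> v) (at t)"
proof -
  have z: "x + t \<cdot>\<^sub>v v \<in> carrier_vec p" using x v by simp
  have "((\<lambda>s. f ((x + t \<cdot>\<^sub>v v) + s \<cdot>\<^sub>v v)) has_real_derivative grad p f (x + t \<cdot>\<^sub>v v) \<bullet> v) (at 0)"
    by (rule has_gradient_line_deriv[OF has_gradient_grad[OF f z] z v])
  moreover have "(x + t \<cdot>\<^sub>v v) + s \<cdot>\<^sub>v v = x + (s + t) \<cdot>\<^sub>v v" for s
    using x v by (intro eq_vecI) (auto simp: algebra_simps)
  ultimately show ?thesis using DERIV_shift[of "\<lambda>t. f (x + t \<cdot>\<^sub>v v)" _ 0 t] by simp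
qed

text \<open>
  Monotonicity of the gradient makes the derivative along the segment at least its value at \<open>x\<close>.
\<close>

lemma convex_lower_bound:
  assumes f: "differentiable_vec p f"
    and mono: "\<And>x y. x \<in> carrier_vec p \<Longrightarrow> y \<in> carrier_vec p \<Longrightarrow>
       (grad p f x - grad p f y) \<bullet> (x - y) \<ge> 0"
    and x: "x \<in> carrier_vec p" and v: "v \<in> carrier_vec p"
  shows "f x + grad p f x \<bullet> v \<le> f (x + v)"
proof -
  let ?\<phi> = "\<lambda>t. f (x + t \<cdot>\<^sub>v v) - t * (grad p f x \<bullet> v)"
  have "?\<phi> 0 \<le> ?\<phi> 1"
  proof (rule DERIV_nonneg_imp_nondecreasing[of 0 1 ?\<phi>])
    fix t :: real assume t: "0 \<le> t" "t \<le> 1"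
    let ?z = "x + t \<cdot>\<^sub>v v"
    have z: "?z \<in> carrier_vec p" and zx: "?z - x = t \<cdot>\<^sub>v v" using x v by auto
    have gc: "grad p f ?z \<in> carrier_vec p" "grad p f x \<in> carrier_vec p"
      using grad_carrier[OF f] z x by auto
    have "0 \<le> (grad p f ?z - grad p f x) \<bullet> (?z - x)" by (rule mono[OF z x])
    also have "\<dots> = t * (grad p f ?z \<bullet> v - grad p f x \<bullet> v)"
      unfolding zx using gc v by (simp add: minus_scalar_prod_distrib[of _ p])
    finally have "0 \<le> grad p f ?z \<bullet> v - grad p f x \<bullet> v" if "t > 0"
      using that by (simp add: zero_le_mult_iff)
    moreover have "grad p f ?z = grad p f x" if "t = 0" using that add_zero_smult_vec[OF x v] by simp
    ultimately have "0 \<le> grad p f ?z \<bullet> v - grad p f x \<bullet> v" using t by (cases "t = 0") auto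
    thus "\<exists>D. (?\<phi> has_real_derivative D) (at t) \<and> 0 \<le> D"
      by (intro exI conjI) (auto intro!: derivative_eq_intros line_deriv[OF f x v])
  qed simp
  thus ?thesis using add_zero_smult_vec[OF x v] v by simp
qed

text \<open>
  The derivative along the segment exceeds its value at \<open>x\<close> by at most \<open>L t \<parallel>v\<parallel>\<^sup>2\<close>.
\<close>

lemma descent_upper_bound:
  assumes f: "lipschitz_gradient p L f"
    and x: "x \<in> carrier_vec p" and v: "v \<in> carrier_vec p"
  shows "f (x + v) \<le> f x + grad p f x \<bullet> v + L / 2 * (v \<bullet> v)"
proof -
  have df: "differentiable_vec p f" using f by (simp add: lipschitz_gradient_def)
  let ?\<phi> = "\<lambda>t. f (x + t \<cdot>\<^sub>v v) - t * (grad p f x \<bullet> v) - L / 2 * t\<^sup>2 * (v \<bullet> v)"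
  have "?\<phi> 0 \<ge> ?\<phi> 1"
  proof (rule DERIV_nonpos_imp_nonincreasing[of 0 1 ?\<phi>])
    fix t :: real assume t: "0 \<le> t" "t \<le> 1"
    let ?z = "x + t \<cdot>\<^sub>v v"
    have z: "?z \<in> carrier_vec p" and zx: "?z - x = t \<cdot>\<^sub>v v" using x v by auto
    have gc: "grad p f ?z \<in> carrier_vec p" "grad p f x \<in> carrier_vec p"
      using grad_carrier[OF df] z x by auto
    have "grad p f ?z \<bullet> v - grad p f x \<bullet> v = (grad p f ?z - grad p f x) \<bullet> v"
      using gc v by (simp add: minus_scalar_prod_distrib[of _ p])
    also have "\<dots> \<le> vec_norm2 (grad p f ?z - grad p f x) * vec_norm2 v"
      using gc v by (intro Cauchy_Schwarz_norm2[of _ p]) auto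
    also have "\<dots> \<le> (L * vec_norm2 (?z - x)) * vec_norm2 v"
      using f z x by (intro mult_right_mono vec_norm2_nonneg) (auto simp: lipschitz_gradient_def)
    also have "vec_norm2 (?z - x) = t * vec_norm2 v"
      unfolding zx using v t by (simp add: vec_norm2_def real_sqrt_mult mult.assoc[symmetric])
    also have "(L * (t * vec_norm2 v)) * vec_norm2 v = L * t * (v \<bullet> v)"
      by (simp add: vec_norm2_squared[symmetric] power2_eq_square)
    finally have "grad p f ?z \<bullet> v - grad p f x \<bullet> v - L * t * (v \<bullet> v) \<le> 0" by simp
    thus "\<exists>D. (?\<phi> has_real_derivative D) (at t) \<and> D \<le> 0"
      by (intro exI conjI) (auto intro!: derivative_eq_intros line_deriv[OF df x v] simp: mult_ac)
  qed simp
  thus ?thesis using add_zero_smult_vec[OF x v] v by simp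
qed

text \<open>
  Baillon--Haddad: evaluate \<open>f\<close> at \<open>y - w / L\<close> with \<open>w = \<nabla>f(y) - \<nabla>f(x)\<close>, bounding it from below by the
  tangent at \<open>x\<close> and from above by the quadratic model at \<open>y\<close>. The resulting improved convexity
  inequality, added to the one with \<open>x\<close> and \<open>y\<close> exchanged, is the claim. The weaker bound
  \<open>(L\<^sup>2 / \<mu>) \<langle>\<nabla>f(x) - \<nabla>f(y), x - y\<rangle>\<close>, immediate from the definitions, would put \<open>\<kappa>\<close> instead of
  \<open>sqrt \<kappa>\<close> into the final rate.
\<close>

lemma gradient_cocoercive:
  assumes f: "lipschitz_gradient p L f" and L: "L > 0"
    and mono: "\<And>x y. x \<in> carrier_vec p \<Longrightarrow> y \<in> carrier_vec p \<Longrightarrow>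
       (grad p f x - grad p f y) \<bullet> (x - y) \<ge> 0"
    and x: "x \<in> carrier_vec p" and y: "y \<in> carrier_vec p"
  shows "(grad p f x - grad p f y) \<bullet> (grad p f x - grad p f y)
    \<le> L * ((grad p f x - grad p f y) \<bullet> (x - y))"
proof -
  have df: "differentiable_vec p f" using f by (simp add: lipschitz_gradient_def)
  have half: "f x + grad p f x \<bullet> (y - x)
      + 1 / (2 * L) * ((grad p f y - grad p f x) \<bullet> (grad p f y - grad p f x)) \<le> f y"
    if x: "x \<in> carrier_vec p" and y: "y \<in> carrier_vec p" for x y
  proof -
    have gx: "grad p f x \<in> carrier_vec p" and gy: "grad p f y \<in> carrier_vec p"
      using grad_carrier[OF df] x y by auto
    define w where "w = grad p f y - grad p f x"
    have w: "w \<in> carrier_vec p" using gx gy by (simp add: w_def)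
    let ?v = "(- (1 / L)) \<cdot>\<^sub>v w"
    have v: "?v \<in> carrier_vec p" using w by simp
    have eq: "x + ((y - x) + ?v) = y + ?v"
      using x y w by (intro eq_vecI) auto
    have "f x + grad p f x \<bullet> ((y - x) + ?v) \<le> f (x + ((y - x) + ?v))"
      using x y v by (intro convex_lower_bound df mono) auto
    also have "\<dots> \<le> f y + grad p f y \<bullet> ?v + L / 2 * (?v \<bullet> ?v)"
      unfolding eq by (rule descent_upper_bound[OF f y v])
    finally have "f x + grad p f x \<bullet> (y - x) \<le> f y + (grad p f y \<bullet> ?v - grad p f x \<bullet> ?v) + L / 2 * (?v \<bullet> ?v)"
      using gx x y v by (simp add: scalar_prod_add_distrib[of _ p])
    also have "grad p f y \<bullet> ?v - grad p f x \<bullet> ?v = - (1 / L) * (w \<bullet> w)"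
      using minus_scalar_prod_distrib[OF gy gx v] w by (simp add: w_def[symmetric])
    also have "?v \<bullet> ?v = (1 / L) * ((1 / L) * (w \<bullet> w))" using w by simp
    finally show ?thesis using L unfolding w_def[symmetric] by (simp add: field_simps)
  qed
  have gx: "grad p f x \<in> carrier_vec p" and gy: "grad p f y \<in> carrier_vec p"
    using grad_carrier[OF df] x y by auto
  let ?w = "grad p f x - grad p f y"
  have "(grad p f y - grad p f x) \<bullet> (grad p f y - grad p f x) = ?w \<bullet> ?w"
    using gx gy by (simp add: minus_scalar_prod_distrib[of _ p] scalar_prod_minus_distrib[of _ p])
  moreover have "?w \<bullet> (x - y) = - (grad p f x \<bullet> (y - x)) - grad p f y \<bullet> (x - y)"
    using gx gy x y by (simp add: minus_scalar_prod_distrib[of _ p] scalar_prod_minus_distrib[of _ p])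
  ultimately have "1 / (2 * L) * (?w \<bullet> ?w) + 1 / (2 * L) * (?w \<bullet> ?w) \<le> ?w \<bullet> (x - y)"
    using half[OF x y] half[OF y x] by simp
  thus ?thesis using L by (simp add: field_simps)
qed

text \<open>
  Half of the monotonicity gap \<open>2 \<langle>\<nabla>f(x) - \<nabla>f(y), x - y\<rangle>\<close> pays for the primal error through strong
  convexity, the other half for the gradient error through cocoercivity. The constants are relaxed so
  that one pair serves all agents.
\<close>

lemma strongly_convex_cocoercive_bound:
  assumes sc: "strongly_convex p \<mu>' f" and lip: "lipschitz_gradient p L' f"
    and \<mu>: "0 < \<mu>" "\<mu> \<le> \<mu>'" and L: "0 < L" "L' \<le> L"
    and x: "x \<in> carrier_vec p" and y: "y \<in> carrier_vec p"
  shows "\<mu> * ((x - y) \<bullet> (x - y)) + 1 / L * ((grad p f x - grad p f y) \<bullet> (grad p f x - grad p f y))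
    \<le> 2 * ((grad p f x - grad p f y) \<bullet> (x - y))"
proof -
  have strong: "\<mu> * ((x - y) \<bullet> (x - y)) \<le> (grad p f x - grad p f y) \<bullet> (x - y)"
    if "x \<in> carrier_vec p" "y \<in> carrier_vec p" for x y
  proof -
    have "\<mu> * ((x - y) \<bullet> (x - y)) \<le> \<mu>' * ((x - y) \<bullet> (x - y))"
      using \<mu>(2) by (rule mult_right_mono) (rule scalar_prod_self_nonneg)
    also have "\<dots> \<le> (grad p f x - grad p f y) \<bullet> (x - y)"
      using sc that by (simp add: strongly_convex_def vec_norm2_squared)
    finally show ?thesis .
  qed
  have "L' * vec_norm2 v \<le> L * vec_norm2 v" for v
    using L(2) by (rule mult_right_mono) (rule vec_norm2_nonneg)
  hence lip': "lipschitz_gradient p L f" using lip unfolding lipschitz_gradient_def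
    by (meson order_trans)
  have "0 \<le> (grad p f x - grad p f y) \<bullet> (x - y)"
    if xy: "x \<in> carrier_vec p" "y \<in> carrier_vec p" for x y
  proof -
    have "0 \<le> \<mu> * ((x - y) \<bullet> (x - y))" using \<mu>(1) scalar_prod_self_nonneg[of "x - y"] by simp
    thus ?thesis using strong[OF xy] by linarith
  qed
  from gradient_cocoercive[OF lip' L(1) this x y]
  have "1 / L * ((grad p f x - grad p f y) \<bullet> (grad p f x - grad p f y))
      \<le> (grad p f x - grad p f y) \<bullet> (x - y)"
    using L(1) by (simp add: field_simps)
  thus ?thesis using strong[OF x y] by linarith
qed

text \<open>
  Two points at distance one, which exist because \<open>p \<ge> 1\<close>. This makes the common Lipschitz constant
  positive.
\<close>

lemma strong_convexity_le_lipschitz: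
  assumes sc: "strongly_convex p \<mu> f" and lip: "lipschitz_gradient p L f" and p: "p \<ge> 1"
  shows "\<mu> \<le> L"
proof -
  define x :: "real vec" where "x = unit_vec p 0"
  define y :: "real vec" where "y = 0\<^sub>v p"
  have x: "x \<in> carrier_vec p" and y: "y \<in> carrier_vec p" by (auto simp: x_def y_def)
  have df: "differentiable_vec p f" using sc by (simp add: strongly_convex_def)
  have "x - y = x" unfolding x_def y_def by (intro eq_vecI) auto
  hence N: "(x - y) \<bullet> (x - y) = 1" using p by (simp add: x_def)
  hence N1: "vec_norm2 (x - y) = 1" by (simp add: vec_norm2_def)
  have "\<mu> \<le> (grad p f x - grad p f y) \<bullet> (x - y)"
    using sc x y N1 unfolding strongly_convex_def by fastforce
  also have "\<dots> \<le> vec_norm2 (grad p f x - grad p f y) * vec_norm2 (x - y)"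
    using grad_carrier[OF df x] grad_carrier[OF df y] x y by (intro Cauchy_Schwarz_norm2[of _ p]) auto
  also have "\<dots> \<le> L" using lip x y N1 unfolding lipschitz_gradient_def by fastforce
  finally show ?thesis .
qed

text \<open>
  The objective restricted to the line through \<open>x\<close> in direction \<open>h\<close> has derivative
  \<open>\<langle>\<nabla>f(x) - s + z / b, h\<rangle>\<close> at \<open>x\<close>; taking the first factor itself for \<open>h\<close> shows that it vanishes.
\<close>

lemma prox_optimality:
  assumes f: "differentiable_vec p f" and b: "b > 0"
    and s: "s \<in> carrier_vec p" and r: "r \<in> carrier_vec p"
    and u: "u \<in> carrier_vec p" "u' \<in> carrier_vec p"
    and min: "is_arg_min (\<lambda>v. f v - s \<bullet> v + 1 / (2 * b) * (vec_norm2 (v - r + u - u'))\<^sup>2)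
       (\<lambda>v. v \<in> carrier_vec p) x"
  shows "grad p f x = s - (1 / b) \<cdot>\<^sub>v (x - r + u - u')"
proof -
  have x: "x \<in> carrier_vec p" using min by (simp add: is_arg_min_def)
  define z where "z = x - r + u - u'"
  have z: "z \<in> carrier_vec p" using x r u by (auto simp: z_def)
  define g where "g = grad p f x"
  have g: "g \<in> carrier_vec p" using grad_carrier[OF f x] by (simp add: g_def)
  define h where "h = g - s + (1 / b) \<cdot>\<^sub>v z"
  have h: "h \<in> carrier_vec p" using g s z by (simp add: h_def)
  define \<phi> where "\<phi> = (\<lambda>t. f (x + t \<cdot>\<^sub>v h) - (s \<bullet> x + t * (s \<bullet> h))
     + 1 / (2 * b) * (z \<bullet> z + 2 * t * (z \<bullet> h) + t\<^sup>2 * (h \<bullet> h)))"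
  have \<phi>: "\<phi> t = f (x + t \<cdot>\<^sub>v h) - s \<bullet> (x + t \<cdot>\<^sub>v h)
      + 1 / (2 * b) * (vec_norm2 (x + t \<cdot>\<^sub>v h - r + u - u'))\<^sup>2" for t
  proof -
    have "x + t \<cdot>\<^sub>v h - r + u - u' = z + t \<cdot>\<^sub>v h"
      using x h r u by (intro eq_vecI) (auto simp: z_def)
    moreover have "(z + t \<cdot>\<^sub>v h) \<bullet> (z + t \<cdot>\<^sub>v h) = z \<bullet> z + 2 * t * (z \<bullet> h) + t\<^sup>2 * (h \<bullet> h)"
      using z h comm_scalar_prod[OF z h]
      by (simp add: add_scalar_prod_distrib[of _ p] scalar_prod_add_distrib[of _ p]
          power2_eq_square distrib_left)
    moreover have "s \<bullet> (x + t \<cdot>\<^sub>v h) = s \<bullet> x + t * (s \<bullet> h)"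
      using s x h by (simp add: scalar_prod_add_distrib[of _ p])
    ultimately show ?thesis by (simp add: \<phi>_def vec_norm2_squared)
  qed
  have x0: "x + 0 \<cdot>\<^sub>v h = x" by (rule add_zero_smult_vec[OF x h])
  have D: "(\<phi> has_real_derivative (g \<bullet> h - s \<bullet> h + 1 / b * (z \<bullet> h))) (at 0)"
    using line_deriv[OF f x h, of 0] b unfolding x0 g_def[symmetric] \<phi>_def
    by (auto intro!: derivative_eq_intros simp: field_simps)
  have "\<phi> 0 \<le> \<phi> t" for t
  proof -
    have "x + t \<cdot>\<^sub>v h \<in> carrier_vec p" using x h by simp
    thus ?thesis using min unfolding \<phi> x0 is_arg_min_linorder by blast
  qed
  hence "g \<bullet> h - s \<bullet> h + 1 / b * (z \<bullet> h) = 0"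
    using DERIV_local_min[OF D, of 1] by auto
  moreover have "(g - s + (1 / b) \<cdot>\<^sub>v z) \<bullet> h = g \<bullet> h - s \<bullet> h + 1 / b * (z \<bullet> h)"
    using g s z h by (simp add: add_scalar_prod_distrib[of _ p] minus_scalar_prod_distrib[of _ p])
  ultimately have "h \<bullet> h = 0" unfolding h_def[symmetric] by linarith
  hence h0: "h = 0\<^sub>v p" using scalar_prod_self_pos[OF h] by fastforce
  show ?thesis unfolding z_def[symmetric] g_def[symmetric]
  proof (rule eq_vecI)
    fix i assume "i < dim_vec (s - (1 / b) \<cdot>\<^sub>v z)"
    hence i: "i < p" using z by simp
    have "h $ i = 0" using h0 i by simp
    thus "g $ i = (s - (1 / b) \<cdot>\<^sub>v z) $ i" using i g s z by (simp add: h_def)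
  qed (use g z in auto)
qed

section \<open>The energy of one column during one step\<close>

text \<open>
  Here \<open>a\<close>, \<open>e\<close> and \<open>dx\<close> are the errors after the step and \<open>d\<close> is the change of the gradient. The cross
  terms of the expansion are \<open>- 2 c \<langle>a, U e\<rangle>\<close> and \<open>- 2 \<langle>e, H d\<rangle>\<close>; substituting the step equation into
  the second one cancels the first and leaves \<open>2 \<langle>e, dx\<rangle>\<close>.
\<close>

lemma prox_step_energy_identity:
  assumes U: "(U::real mat) \<in> carrier_mat m n" and H: "H \<in> carrier_mat n n" "H\<^sup>T = H"
    and a: "a \<in> carrier_vec m" and e: "e \<in> carrier_vec n"
    and d: "d \<in> carrier_vec n" and dx: "dx \<in> carrier_vec n"
    and step: "H *\<^sub>v d = - (dx + c \<cdot>\<^sub>v (U\<^sup>T *\<^sub>v a))"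
  shows "c * ((a - U *\<^sub>v e) \<bullet> (a - U *\<^sub>v e)) + (e - d) \<bullet> (H *\<^sub>v (e - d)) =
    c * (a \<bullet> a) + e \<bullet> (H *\<^sub>v e) + c * ((U *\<^sub>v e) \<bullet> (U *\<^sub>v e)) + d \<bullet> (H *\<^sub>v d) + 2 * (e \<bullet> dx)"
proof -
  have Ue: "U *\<^sub>v e \<in> carrier_vec m" and Ua: "U\<^sup>T *\<^sub>v a \<in> carrier_vec n"
    and He: "H *\<^sub>v e \<in> carrier_vec n" and Hd: "H *\<^sub>v d \<in> carrier_vec n" using U H a e d by auto
  have "e \<bullet> (U\<^sup>T *\<^sub>v a) = a \<bullet> (U *\<^sub>v e)"
    using transpose_vec_mult_scalar[OF U e a] comm_scalar_prod[OF e Ua] by simp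
  hence eHd: "e \<bullet> (H *\<^sub>v d) = - (e \<bullet> dx) - c * (a \<bullet> (U *\<^sub>v e))"
    unfolding step scalar_prod_uminus_add_smult[OF e dx Ua] by simp
  have dHe: "d \<bullet> (H *\<^sub>v e) = e \<bullet> (H *\<^sub>v d)" by (rule symmetric_bilinear[OF H d e])
  have 1: "(a - U *\<^sub>v e) \<bullet> (a - U *\<^sub>v e) = a \<bullet> a - 2 * (a \<bullet> (U *\<^sub>v e)) + (U *\<^sub>v e) \<bullet> (U *\<^sub>v e)"
    using a Ue comm_scalar_prod[OF a Ue]
    by (simp add: minus_scalar_prod_distrib[of _ m] scalar_prod_minus_distrib[of _ m])
  have "H *\<^sub>v (e - d) = H *\<^sub>v e - H *\<^sub>v d" using H e d by (simp add: mult_minus_distrib_mat_vec[of _ n n])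
  hence 2: "(e - d) \<bullet> (H *\<^sub>v (e - d)) = e \<bullet> (H *\<^sub>v e) - 2 * (e \<bullet> (H *\<^sub>v d)) + d \<bullet> (H *\<^sub>v d)"
    using e d He Hd dHe
    by (simp add: minus_scalar_prod_distrib[of _ n] scalar_prod_minus_distrib[of _ n])
  show ?thesis unfolding 1 2 eHd by (simp add: algebra_simps)
qed

text \<open>
  The step equation expresses \<open>c U\<^sup>T a\<close> by \<open>dx\<close> and \<open>H d\<close>, so the lower bound on \<open>U\<^sup>T\<close> turns control of
  \<open>dx\<close> and \<open>d\<close> into control of the dual error \<open>a\<close>.
\<close>

lemma prox_step_energy_bound:
  assumes U: "(U::real mat) \<in> carrier_mat m n" and H: "pos_semidef n H"
    and \<beta>: "\<beta> > 0" "\<And>v. v \<in> carrier_vec n \<Longrightarrow> v \<bullet> (H *\<^sub>v v) \<le> \<beta> * (v \<bullet> v)"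
    and c: "c > 0" and lam: "lam > 0" "lam * (a \<bullet> a) \<le> (U\<^sup>T *\<^sub>v a) \<bullet> (U\<^sup>T *\<^sub>v a)"
    and a: "a \<in> carrier_vec m" and e: "e \<in> carrier_vec n"
    and d: "d \<in> carrier_vec n" and dx: "dx \<in> carrier_vec n"
    and step: "H *\<^sub>v d = - (dx + c \<cdot>\<^sub>v (U\<^sup>T *\<^sub>v a))"
  shows "c * (a \<bullet> a) + e \<bullet> (H *\<^sub>v e)
    \<le> 2 / (c * lam) * (dx \<bullet> dx + \<beta> * (d \<bullet> (H *\<^sub>v d))) + \<beta> * (e \<bullet> e)"
proof -
  have Hc: "H \<in> carrier_mat n n" using H by (simp add: pos_semidef_def)
  have Ua: "U\<^sup>T *\<^sub>v a \<in> carrier_vec n" and Hd: "H *\<^sub>v d \<in> carrier_vec n" using U Hc a d by auto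
  have eq: "c \<cdot>\<^sub>v (U\<^sup>T *\<^sub>v a) = - (dx + H *\<^sub>v d)"
    by (rule uminus_add_smult_swap[OF Hd dx Ua step])
  have "c\<^sup>2 * (lam * (a \<bullet> a)) \<le> c\<^sup>2 * ((U\<^sup>T *\<^sub>v a) \<bullet> (U\<^sup>T *\<^sub>v a))"
    by (intro mult_left_mono lam) auto
  also have "\<dots> = (c \<cdot>\<^sub>v (U\<^sup>T *\<^sub>v a)) \<bullet> (c \<cdot>\<^sub>v (U\<^sup>T *\<^sub>v a))"
    using Ua by (simp add: power2_eq_square)
  also have "\<dots> = (dx + H *\<^sub>v d) \<bullet> (dx + H *\<^sub>v d)" unfolding eq using dx Hd by simp
  also have "\<dots> \<le> 2 * (dx \<bullet> dx) + 2 * ((H *\<^sub>v d) \<bullet> (H *\<^sub>v d))"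
    using scalar_prod_self_nonneg[of "dx - H *\<^sub>v d"] dx Hd comm_scalar_prod[OF dx Hd]
    by (simp add: minus_scalar_prod_distrib[of _ n] scalar_prod_minus_distrib[of _ n]
        add_scalar_prod_distrib[of _ n] scalar_prod_add_distrib[of _ n])
  also have "\<dots> \<le> 2 * (dx \<bullet> dx + \<beta> * (d \<bullet> (H *\<^sub>v d)))"
    using pos_semidef_image_bound[OF H \<beta> d] by simp
  finally have "c * (a \<bullet> a) \<le> 2 / (c * lam) * (dx \<bullet> dx + \<beta> * (d \<bullet> (H *\<^sub>v d)))"
    using c lam(1) by (simp add: field_simps power2_eq_square)
  thus ?thesis using \<beta>(2)[OF e] by linarith
qed

text \<open>
  The term in the last line is kept, because its sign is known only after summation over all columns:
  strong convexity couples the coordinates of an agent. In the application \<open>\<nu>\<close> is \<open>1 / L\<close>.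
\<close>

lemma prox_step_contraction:
  assumes U: "(U::real mat) \<in> carrier_mat m n" and H: "pos_semidef n H"
    and \<beta>: "\<beta> > 0" "\<And>v. v \<in> carrier_vec n \<Longrightarrow> v \<bullet> (H *\<^sub>v v) \<le> \<beta> * (v \<bullet> v)"
    and c: "c > 0" and lam: "lam > 0" "lam * (a \<bullet> a) \<le> (U\<^sup>T *\<^sub>v a) \<bullet> (U\<^sup>T *\<^sub>v a)"
    and a: "a \<in> carrier_vec m" and e: "e \<in> carrier_vec n"
    and d: "d \<in> carrier_vec n" and dx: "dx \<in> carrier_vec n"
    and step: "H *\<^sub>v d = - (dx + c \<cdot>\<^sub>v (U\<^sup>T *\<^sub>v a))"
    and \<delta>: "\<delta> \<ge> 0" "\<delta> * (2 / (c * lam)) \<le> \<mu>" "\<delta> * (2 * \<beta> / (c * lam)) \<le> 1" "\<delta> * \<beta> \<le> \<nu>"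
  shows "(1 + \<delta>) * (c * (a \<bullet> a) + e \<bullet> (H *\<^sub>v e)) \<le>
    c * ((a - U *\<^sub>v e) \<bullet> (a - U *\<^sub>v e)) + (e - d) \<bullet> (H *\<^sub>v (e - d))
    + (\<mu> * (dx \<bullet> dx) + \<nu> * (e \<bullet> e) - 2 * (e \<bullet> dx))"
proof -
  have Hc: "H \<in> carrier_mat n n" "H\<^sup>T = H" and dHd: "d \<bullet> (H *\<^sub>v d) \<ge> 0"
    using H d by (auto simp: pos_semidef_def)
  have "\<delta> * (c * (a \<bullet> a) + e \<bullet> (H *\<^sub>v e))
      \<le> \<delta> * (2 / (c * lam) * (dx \<bullet> dx + \<beta> * (d \<bullet> (H *\<^sub>v d))) + \<beta> * (e \<bullet> e))"
    using prox_step_energy_bound[OF U H \<beta> c lam a e d dx step] \<delta>(1) by (rule mult_left_mono)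
  also have "\<dots> = (\<delta> * (2 / (c * lam))) * (dx \<bullet> dx)
      + (\<delta> * (2 * \<beta> / (c * lam))) * (d \<bullet> (H *\<^sub>v d)) + (\<delta> * \<beta>) * (e \<bullet> e)"
    by (simp add: algebra_simps add_divide_distrib)
  also have "\<dots> \<le> \<mu> * (dx \<bullet> dx) + 1 * (d \<bullet> (H *\<^sub>v d)) + \<nu> * (e \<bullet> e)"
    by (intro add_mono mult_right_mono \<delta> scalar_prod_self_nonneg dHd)
  finally have "\<delta> * (c * (a \<bullet> a) + e \<bullet> (H *\<^sub>v e))
      \<le> \<mu> * (dx \<bullet> dx) + d \<bullet> (H *\<^sub>v d) + \<nu> * (e \<bullet> e)" by simp
  moreover have "c * ((U *\<^sub>v e) \<bullet> (U *\<^sub>v e)) \<ge> 0" using c scalar_prod_self_nonneg[of "U *\<^sub>v e"] by simp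
  moreover note prox_step_energy_identity[OF U Hc a e d dx step]
  ultimately show ?thesis by (simp add: distrib_right)
qed

section \<open>The iterates of Mirror-P-EXTRA\<close>

lemma row_grad_rows:
  assumes "differentiable_vec p (f i)" "X \<in> carrier_mat n p" "i < n"
  shows "row (grad_rows n p f X) i = grad p (f i) (row X i)"
  using grad_carrier[OF assms(1), of "row X i"] assms(2,3)
  by (intro eq_vecI) (auto simp: grad_rows_def)

text \<open>
  Move the allocation along \<open>D = U\<^sup>T U \<nabla>f(X)\<close>. This is feasible because \<open>U\<close> annihilates the all-ones
  vector, so the columns of \<open>D\<close> sum to zero. The derivative of the objective along \<open>D\<close> is the sum of
  the \<open>\<parallel>U g\<^sub>l\<parallel>\<^sup>2\<close> over the columns \<open>g\<^sub>l\<close> of \<open>\<nabla>f(X)\<close>, and it must vanish at a minimizer.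
\<close>

lemma optimal_allocation_gradients_agree:
  assumes opt: "optimal_allocation n p f r X" 
    and U: "(U::real mat) \<in> carrier_mat m n" and ones: "U *\<^sub>v vec n (\<lambda>_. 1) = 0\<^sub>v m"
    and f: "\<And>i. i < n \<Longrightarrow> differentiable_vec p (f i)"
  shows "U * grad_rows n p f X = 0\<^sub>m m p"
proof -
  have X: "X \<in> carrier_mat n p" and feas: "\<forall>l<p. (\<Sum>i<n. X $$ (i, l) - r $$ (i, l)) = 0"
    and mini: "\<And>Y. Y \<in> carrier_mat n p \<Longrightarrow> (\<forall>l<p. (\<Sum>i<n. Y $$ (i, l) - r $$ (i, l)) = 0) \<Longrightarrow>
       (\<Sum>i<n. f i (row X i)) \<le> (\<Sum>i<n. f i (row Y i))"
    using opt unfolding optimal_allocation_def is_arg_min_linorder by auto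
  let ?G = "grad_rows n p f X"
  have G: "?G \<in> carrier_mat n p" by (simp add: grad_rows_def)
  have rG: "row ?G i = grad p (f i) (row X i)" if i: "i < n" for i
    using grad_carrier[OF f[OF i], of "row X i"] X i by (intro eq_vecI) (auto simp: grad_rows_def)
  define D where "D = U\<^sup>T * (U * ?G)"
  have D: "D \<in> carrier_mat n p" using U G by (simp add: D_def)
  have cD: "col D l = U\<^sup>T *\<^sub>v (U *\<^sub>v col ?G l)" if "l < p" for l
    using that U G by (simp del: col_mult add: D_def col_mult2[of _ n m _ p] col_mult2[of _ m n _ p])
  have Dsum: "(\<Sum>i<n. D $$ (i, l)) = 0" if l: "l < p" for l
  proof -
    have "(\<Sum>i<n. D $$ (i, l)) = col D l \<bullet> vec n (\<lambda>_. 1)"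
      using D l by (simp add: scalar_prod_def lessThan_atLeast0)
    also have "\<dots> = (U *\<^sub>v col ?G l) \<bullet> (U *\<^sub>v vec n (\<lambda>_. 1))"
      unfolding cD[OF l] using U G l by (intro transpose_vec_mult_scalar) auto
    also have "\<dots> = 0" unfolding ones using U G l by auto
    finally show ?thesis .
  qed
  let ?\<phi> = "\<lambda>t. \<Sum>i<n. f i (row X i + t \<cdot>\<^sub>v row D i)"
  have "?\<phi> 0 \<le> ?\<phi> t" for t
  proof -
    let ?Y = "X + t \<cdot>\<^sub>m D"
    have "(\<Sum>i<n. f i (row X i)) \<le> (\<Sum>i<n. f i (row ?Y i))"
    proof (rule mini)
      show "\<forall>l<p. (\<Sum>i<n. ?Y $$ (i, l) - r $$ (i, l)) = 0"
      proof (intro allI impI)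
        fix l assume l: "l < p"
        have "(\<Sum>i<n. ?Y $$ (i, l) - r $$ (i, l))
            = (\<Sum>i<n. X $$ (i, l) - r $$ (i, l)) + t * (\<Sum>i<n. D $$ (i, l))"
          unfolding sum_distrib_left sum.distrib[symmetric] using X D l by (intro sum.cong) auto
        thus "(\<Sum>i<n. ?Y $$ (i, l) - r $$ (i, l)) = 0" using feas Dsum l by simp
      qed
    qed (use X D in auto)
    moreover have "row ?Y i = row X i + t \<cdot>\<^sub>v row D i" if "i < n" for i using X D that by auto
    moreover have "row X i + 0 \<cdot>\<^sub>v row D i = row X i" if "i < n" for i
      using X D that by (intro add_zero_smult_vec[of _ p]) auto
    ultimately show ?thesis by simp
  qed
  moreover have "(?\<phi> has_real_derivative (\<Sum>i<n. row ?G i \<bullet> row D i)) (at 0)"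
  proof (rule DERIV_sum)
    fix i assume "i \<in> {..<n}"
    hence i: "i < n" by simp
    have r: "row X i \<in> carrier_vec p" "row D i \<in> carrier_vec p" using X D i by auto
    have "row X i + 0 \<cdot>\<^sub>v row D i = row X i" using r by (rule add_zero_smult_vec)
    thus "((\<lambda>t. f i (row X i + t \<cdot>\<^sub>v row D i)) has_real_derivative row ?G i \<bullet> row D i) (at 0)"
      using line_deriv[OF f[OF i] r, of 0] rG[OF i] by simp
  qed
  ultimately have "(\<Sum>i<n. row ?G i \<bullet> row D i) = 0"
    using DERIV_local_min[of ?\<phi> _ 0 1] by auto
  also have "(\<Sum>i<n. row ?G i \<bullet> row D i) = (\<Sum>l<p. col ?G l \<bullet> col D l)"
    unfolding scalar_prod_def using G D
    by (simp add: lessThan_atLeast0) (rule sum.swap)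
  also have "\<dots> = (\<Sum>l<p. (U *\<^sub>v col ?G l) \<bullet> (U *\<^sub>v col ?G l))"
  proof (rule sum.cong)
    fix l assume "l \<in> {..<p}"
    hence l: "l < p" by simp
    have g: "col ?G l \<in> carrier_vec n" and Ug: "U *\<^sub>v col ?G l \<in> carrier_vec m" using U G l by auto
    show "col ?G l \<bullet> col D l = (U *\<^sub>v col ?G l) \<bullet> (U *\<^sub>v col ?G l)"
      unfolding cD[OF l] using transpose_vec_mult_scalar[OF U g Ug] U g Ug
      by (simp add: comm_scalar_prod[of _ n])
  qed simp
  finally have "(\<Sum>l<p. (U *\<^sub>v col ?G l) \<bullet> (U *\<^sub>v col ?G l)) = 0" .
  hence zero: "(U *\<^sub>v col ?G l) \<bullet> (U *\<^sub>v col ?G l) = 0" if "l < p" for l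
    using that scalar_prod_self_nonneg by (subst (asm) sum_nonneg_eq_0_iff) auto
  have colz: "U *\<^sub>v col ?G l = 0\<^sub>v m" if l: "l < p" for l
  proof (rule ccontr)
    assume "U *\<^sub>v col ?G l \<noteq> 0\<^sub>v m"
    with scalar_prod_self_pos[of "U *\<^sub>v col ?G l" m] U G l zero[OF l] show False by auto
  qed
  show ?thesis
  proof (rule eq_matI)
    fix i l assume "i < dim_row (0\<^sub>m m p :: real mat)" "l < dim_col (0\<^sub>m m p :: real mat)"
    hence il: "i < m" "l < p" by auto
    have "(U * ?G) $$ (i, l) = (U *\<^sub>v col ?G l) $ i" using U G il by simp
    thus "(U * ?G) $$ (i, l) = 0\<^sub>m m p $$ (i, l)" using colz il by simp
  qed (use U G in auto)
qed

text \<open>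
  The update of \<open>s\<close> is exactly the right-hand side of the optimality condition of the inner
  minimization.
\<close>

lemma mirror_p_extra_tracks_gradient:
  assumes run: "mirror_p_extra n p G W f r (\<lambda>_. \<beta>) c x s y"
    and \<beta>: "\<beta> > 0" and r: "r \<in> carrier_mat n p"
    and f: "\<And>i. i < n \<Longrightarrow> differentiable_vec p (f i)"
  shows "s k = grad_rows n p f (x k)"
proof -
  have xs: "x k \<in> carrier_mat n p" "s k \<in> carrier_mat n p" for k
    using run by (auto simp: mirror_p_extra_def)
  have y: "y (int k) \<in> carrier_mat n p" "y (int k - 1) \<in> carrier_mat n p" for k
    using run by (auto simp: mirror_p_extra_def)
  have "row (s k) i = grad p (f i) (row (x k) i)" if i: "i < n" for i
  proof (cases k)
    case 0
    thus ?thesis using run i by (simp add: mirror_p_extra_def)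
  next
    case (Suc m)
    have min: "is_arg_min
          (\<lambda>v. f i v - row (s m) i \<bullet> v
             + 1 / (2 * \<beta>) * (vec_norm2 (v - row r i + (2 * c) \<cdot>\<^sub>v row (y (int m)) i
                                           - c \<cdot>\<^sub>v row (y (int m - 1)) i))\<^sup>2)
          (\<lambda>v. v \<in> carrier_vec p) (row (x (Suc m)) i)"
      and upd: "row (s (Suc m)) i = row (s m) i
          - (1 / \<beta>) \<cdot>\<^sub>v (row (x (Suc m)) i - row r i + (2 * c) \<cdot>\<^sub>v row (y (int m)) i
                           - c \<cdot>\<^sub>v row (y (int m - 1)) i)"
      using run i unfolding mirror_p_extra_def by blast+
    have "grad p (f i) (row (x (Suc m)) i) = row (s (Suc m)) i"
      unfolding upd
      by (rule prox_optimality[OF f[OF i] \<beta> _ _ _ _ min]) (use xs[of m] y[of m] r i in auto)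
    thus ?thesis using Suc by simp
  qed
  hence "row (s k) i = row (grad_rows n p f (x k)) i" if "i < n" for i
    using row_grad_rows[of p f i "x k" n] f[OF that] xs(1)[of k] that by simp
  thus ?thesis using xs(2)[of k] by (intro eq_rowI) (auto simp: grad_rows_def)
qed

text \<open>
  Summing over the closed neighborhood is summing over all agents, because compatible \<open>W\<close> vanishes
  elsewhere.
\<close>

lemma mirror_p_extra_dual_update:
  assumes run: "mirror_p_extra n p G W f r b c x s y"
    and G: "connected_graph_on n G" and W: "graph_compatible n G W"
  shows "y (int k) = y (int k - 1) + W * s k"
proof (rule eq_matI)
  have sk: "s k \<in> carrier_mat n p" and yk: "y (int k) \<in> carrier_mat n p" "y (int k - 1) \<in> carrier_mat n p"
    using run by (auto simp: mirror_p_extra_def)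
  have Wc: "W \<in> carrier_mat n n" using W by (simp add: graph_compatible_def)
  show "dim_row (y (int k)) = dim_row (y (int k - 1) + W * s k)"
    "dim_col (y (int k)) = dim_col (y (int k - 1) + W * s k)" using sk yk Wc by auto
  fix i l assume "i < dim_row (y (int k - 1) + W * s k)" "l < dim_col (y (int k - 1) + W * s k)"
  hence i: "i < n" and l: "l < p" using Wc sk by auto
  interpret pair_graph G using G by (simp add: connected_graph_on_def)
  have nb: "neighbors G i \<union> {i} \<subseteq> {..<n}"
    using arc_snd_in_verts G i by (force simp: neighbors_def connected_graph_on_def)
  have "row (y (int k)) i = row (y (int k - 1)) i
        + vec p (\<lambda>l. \<Sum>j\<in>neighbors G i \<union> {i}. W $$ (i, j) * s k $$ (j, l))"
    using run i unfolding mirror_p_extra_def by blast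
  from arg_cong[OF this, of "\<lambda>v. v $ l"]
  have "y (int k) $$ (i, l) = y (int k - 1) $$ (i, l)
      + (\<Sum>j\<in>neighbors G i \<union> {i}. W $$ (i, j) * s k $$ (j, l))"
    using yk i l by simp
  also have "(\<Sum>j\<in>neighbors G i \<union> {i}. W $$ (i, j) * s k $$ (j, l)) = (\<Sum>j<n. W $$ (i, j) * s k $$ (j, l))"
    using nb W i by (intro sum.mono_neutral_left) (auto simp: neighbors_def graph_compatible_def)
  also have "\<dots> = (W * s k) $$ (i, l)"
    using Wc sk i l by (simp add: scalar_prod_def lessThan_atLeast0)
  finally show "y (int k) $$ (i, l) = (y (int k - 1) + W * s k) $$ (i, l)"
    using Wc sk yk i l by simp
qed

text \<open>
  Stated at \<open>k - 1\<close> so that the induction starts at the initial value \<open>q (-1)\<close>.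
\<close>

lemma q_carrier:
  assumes "(U::real mat) \<in> carrier_mat m n" "q (-1) = 0\<^sub>m m p"
    and "\<And>k. q (int k) = q (int k - 1) + U * grad_rows n p f (x k)"
  shows "q (int k - 1) \<in> carrier_mat m p"
proof (induction k)
  case (Suc k)
  thus ?case using assms(1) assms(3)[of k] by (simp add: grad_rows_def)
qed (simp add: assms(2))

text \<open>
  Since \<open>y = U\<^sup>T q\<close>, the extrapolation \<open>2 c y\<^sup>k - c y\<^sup>k\<^sup>-\<^sup>1\<close> equals \<open>c U\<^sup>T q\<^sup>k\<^sup>+\<^sup>1 - c W (g\<^sup>k\<^sup>+\<^sup>1 - g\<^sup>k)\<close>.
  This makes the step implicit in the new dual variable, with \<open>\<beta> I - c W\<close> in place of \<open>\<beta> I\<close>; the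
  relation between \<open>xs\<close> and \<open>qs\<close> then removes \<open>r\<close>.
\<close>

lemma mirror_p_extra_column_step:
  assumes run: "mirror_p_extra n p G W f r (\<lambda>_. \<beta>) c x s y"
    and G: "connected_graph_on n G" and compat: "graph_compatible n G W"
    and U: "(U::real mat) \<in> carrier_mat m n" and W: "W = U\<^sup>T * U"
    and \<beta>: "\<beta> > 0" and r: "r \<in> carrier_mat n p"
    and f: "\<And>i. i < n \<Longrightarrow> differentiable_vec p (f i)"
    and q: "q (-1) = 0\<^sub>m m p" "\<And>k. q (int k) = q (int k - 1) + U * grad_rows n p f (x k)"
    and xs: "xs \<in> carrier_mat n p" and qs: "qs \<in> carrier_mat m p"
    and kkt: "xs - r + c \<cdot>\<^sub>m (U\<^sup>T * qs) = 0\<^sub>m n p" and l: "l < p"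
  defines "g \<equiv> \<lambda>k. grad_rows n p f (x k)"
  shows "(mat_diag n (\<lambda>_. \<beta>) - c \<cdot>\<^sub>m W) *\<^sub>v (col (g (Suc k)) l - col (g k) l)
    = - (col (x (Suc k) - xs) l + c \<cdot>\<^sub>v (U\<^sup>T *\<^sub>v (col (q (int (Suc k)) - qs) l)))"
proof -
  have xk: "x k \<in> carrier_mat n p" and yk: "y (int k) \<in> carrier_mat n p" "y (int k - 1) \<in> carrier_mat n p" for k
    using run by (auto simp: mirror_p_extra_def)
  have gk: "g k \<in> carrier_mat n p" for k by (simp add: g_def grad_rows_def)
  have sk: "s k = g k" for k unfolding g_def by (rule mirror_p_extra_tracks_gradient[OF run \<beta> r f])
  have qq: "q (int k) = q (int k - 1) + U * g k" for k using q(2) by (simp add: g_def)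
  have qc: "q (int k - 1) \<in> carrier_mat m p" for k by (rule q_carrier[OF U q])
  have qc': "q (int k) \<in> carrier_mat m p" for k using qc[of "Suc k"] by simp
  have Wc: "W \<in> carrier_mat n n" using U by (simp add: W)
  have Wg: "W * g k = U\<^sup>T * (U * g k)" for k unfolding W using U gk[of k] by (simp add: assoc_mult_mat[of _ n m])
  have yq: "y (int k - 1) = U\<^sup>T * q (int k - 1)" for k
  proof (induction k)
    case 0
    have "y (- 1) = 0\<^sub>m n p" using run by (simp add: mirror_p_extra_def)
    thus ?case using U by (simp add: q(1))
  next
    case (Suc k)
    have "y (int k) = U\<^sup>T * q (int k - 1) + U\<^sup>T * (U * g k)"
      using mirror_p_extra_dual_update[OF run G compat, of k] Suc by (simp add: sk Wg)
    also have "\<dots> = U\<^sup>T * q (int k)"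
      unfolding qq using U qc[of k] gk[of k] by (intro mult_add_distrib_mat[symmetric]) auto
    finally show ?case by simp
  qed
  have yq': "y (int k) = U\<^sup>T * q (int k)" for k using yq[of "Suc k"] by simp
  have gcol: "col (g k) l \<in> carrier_vec n" for k using gk[of k] l by simp
  have qcol: "col (q (int k)) l \<in> carrier_vec m" for k using qc'[of k] l by simp
  show ?thesis
  proof (rule eq_vecI)
    fix i assume "i < dim_vec (- (col (x (Suc k) - xs) l + c \<cdot>\<^sub>v (U\<^sup>T *\<^sub>v (col (q (int (Suc k)) - qs) l))))"
    hence i: "i < n" using U by simp
    let ?\<Delta> = "col (g (Suc k)) l - col (g k) l"
    have \<Delta>: "?\<Delta> \<in> carrier_vec n" using gcol by simp
    have "mat_diag n (\<lambda>_. \<beta>) *\<^sub>v ?\<Delta> = \<beta> \<cdot>\<^sub>v ?\<Delta>"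
    proof -
      have "mat_diag n (\<lambda>_. \<beta>) = \<beta> \<cdot>\<^sub>m 1\<^sub>m n" by (intro eq_matI) (auto simp: mat_diag_def)
      thus ?thesis using smult_mat_mult_vec[of "1\<^sub>m n" n n ?\<Delta> \<beta>] \<Delta> by simp
    qed
    hence "(mat_diag n (\<lambda>_. \<beta>) - c \<cdot>\<^sub>m W) *\<^sub>v ?\<Delta> = \<beta> \<cdot>\<^sub>v ?\<Delta> - c \<cdot>\<^sub>v (W *\<^sub>v ?\<Delta>)"
      using minus_mult_distrib_mat_vec[OF _ _ \<Delta>, of "mat_diag n (\<lambda>_. \<beta>)" n "c \<cdot>\<^sub>m W"]
        smult_mat_mult_vec[OF Wc \<Delta>, of c] Wc by simp
    moreover have "W *\<^sub>v ?\<Delta> = W *\<^sub>v col (g (Suc k)) l - W *\<^sub>v col (g k) l"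
      by (rule mult_minus_distrib_mat_vec[OF Wc gcol gcol])
    ultimately have lhs: "((mat_diag n (\<lambda>_. \<beta>) - c \<cdot>\<^sub>m W) *\<^sub>v ?\<Delta>) $ i =
        \<beta> * (g (Suc k) $$ (i, l) - g k $$ (i, l))
        - c * ((W * g (Suc k)) $$ (i, l) - (W * g k) $$ (i, l))"
      using i l gk[of k] gk[of "Suc k"] Wc by simp
    have "U\<^sup>T *\<^sub>v (col (q (int (Suc k)) - qs) l) = U\<^sup>T *\<^sub>v col (q (int (Suc k))) l - U\<^sup>T *\<^sub>v col qs l"
    proof -
      have "col (q (int (Suc k)) - qs) l = col (q (int (Suc k))) l - col qs l"
        using qc'[of "Suc k"] qs l by (intro eq_vecI) auto
      moreover have "U\<^sup>T *\<^sub>v (col (q (int (Suc k))) l - col qs l) = U\<^sup>T *\<^sub>v col (q (int (Suc k))) l - U\<^sup>T *\<^sub>v col qs l"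
        using qcol[of "Suc k"] qs l U by (intro mult_minus_distrib_mat_vec[of _ n m]) auto
      ultimately show ?thesis by simp
    qed
    moreover have "(U\<^sup>T *\<^sub>v col (q (int (Suc k))) l) $ i = (U\<^sup>T * q (int (Suc k))) $$ (i, l)"
      using U qc'[of "Suc k"] i l by simp
    moreover have "(U\<^sup>T *\<^sub>v col qs l) $ i = (U\<^sup>T * qs) $$ (i, l)" using U qs i l by simp
    ultimately have rhs: "(- (col (x (Suc k) - xs) l + c \<cdot>\<^sub>v (U\<^sup>T *\<^sub>v (col (q (int (Suc k)) - qs) l)))) $ i
        = - (x (Suc k) $$ (i, l) - xs $$ (i, l)
             + c * ((U\<^sup>T * q (int (Suc k))) $$ (i, l) - (U\<^sup>T * qs) $$ (i, l)))"
      using i l xk[of "Suc k"] xs U by (simp del: index_mult_mat_vec index_mult_mat)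
    have "row (s (Suc k)) i = row (s k) i
          - (1 / \<beta>) \<cdot>\<^sub>v (row (x (Suc k)) i - row r i + (2 * c) \<cdot>\<^sub>v row (y (int k)) i
                           - c \<cdot>\<^sub>v row (y (int k - 1)) i)"
      using run i unfolding mirror_p_extra_def by blast
    from arg_cong[OF this, of "\<lambda>v. v $ l"]
    have "g (Suc k) $$ (i, l) = g k $$ (i, l) - (1 / \<beta>) * (x (Suc k) $$ (i, l) - r $$ (i, l)
        + 2 * c * y (int k) $$ (i, l) - c * y (int k - 1) $$ (i, l))"
      using i l gk[of k] gk[of "Suc k"] xk[of "Suc k"] r yk[of k] by (simp add: sk)
    hence upd: "\<beta> * (g (Suc k) $$ (i, l) - g k $$ (i, l)) = - (x (Suc k) $$ (i, l) - r $$ (i, l)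
        + 2 * c * y (int k) $$ (i, l) - c * y (int k - 1) $$ (i, l))"
      using \<beta> by (simp add: field_simps)
    have yW: "y (int k) $$ (i, l) = y (int k - 1) $$ (i, l) + (W * g k) $$ (i, l)" for k
      using arg_cong[OF mirror_p_extra_dual_update[OF run G compat, of k], of "\<lambda>A. A $$ (i, l)"]
        yk[of k] gk[of k] Wc i l by (simp add: sk del: index_mult_mat(1))
    have y1: "y (int k - 1) $$ (i, l) = y (int k) $$ (i, l) - (W * g k) $$ (i, l)"
      using yW[of k] by simp
    have y2: "(U\<^sup>T * q (int (Suc k))) $$ (i, l) = y (int k) $$ (i, l) + (W * g (Suc k)) $$ (i, l)"
      using yW[of "Suc k"] unfolding yq'[symmetric] by simp
    have kkt': "xs $$ (i, l) - r $$ (i, l) + c * (U\<^sup>T * qs) $$ (i, l) = 0"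
      using arg_cong[OF kkt, of "\<lambda>A. A $$ (i, l)"] xs r U qs i l by (simp del: index_mult_mat(1))
    \<comment> \<open>Both \<open>y\<^sup>k\<^sup>-\<^sup>1\<close> and \<open>U\<^sup>T q\<^sup>k\<^sup>+\<^sup>1\<close> are now written through \<open>y\<^sup>k\<close>; what is left is linear.\<close>
    show "((mat_diag n (\<lambda>_. \<beta>) - c \<cdot>\<^sub>m W) *\<^sub>v ?\<Delta>) $ i =
        (- (col (x (Suc k) - xs) l + c \<cdot>\<^sub>v (U\<^sup>T *\<^sub>v (col (q (int (Suc k)) - qs) l)))) $ i"
      unfolding lhs rhs upd y1 y2 using kkt' by (simp add: algebra_simps)
  qed (use U Wc in auto)
qed

section \<open>Contraction of the error seminorm\<close>

text \<open>
  The metric is block diagonal, and the trace adds up the contributions of the columns. Positive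
  semidefiniteness makes the trace nonnegative, so that the square cancels the square root.
\<close>

lemma seminorm_append_rows:
  assumes Q: "Q \<in> carrier_mat (n - 1) p" and X: "X \<in> carrier_mat n p"
    and H: "pos_semidef n (B - c \<cdot>\<^sub>m W)" and c: "c \<ge> 0"
  shows "(mat_seminorm (metric_mat n c B W) (Q @\<^sub>r X))\<^sup>2 =
    (\<Sum>l<p. c * (col Q l \<bullet> col Q l) + col X l \<bullet> ((B - c \<cdot>\<^sub>m W) *\<^sub>v col X l))"
proof -
  let ?H = "B - c \<cdot>\<^sub>m W" and ?M = "metric_mat n c B W" and ?Z = "Q @\<^sub>r X"
  have Hc: "?H \<in> carrier_mat n n" using H by (simp add: pos_semidef_def)
  have M: "?M \<in> carrier_mat (n - 1 + n) (n - 1 + n)" unfolding metric_mat_def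
    by (intro four_block_carrier_mat Hc) auto
  have Z: "?Z \<in> carrier_mat (n - 1 + n) p" using Q X by (rule carrier_append_rows)
  have ent: "(?Z\<^sup>T * ?M * ?Z) $$ (l, l) =
      c * (col Q l \<bullet> col Q l) + col X l \<bullet> (?H *\<^sub>v col X l)" if l: "l < p" for l
  proof -
    have q: "col Q l \<in> carrier_vec (n - 1)" and x: "col X l \<in> carrier_vec n" using Q X l by auto
    have cZ: "col ?Z l = col Q l @\<^sub>v col X l"
      unfolding append_rows_def using Q X l
      by (subst col_four_block_mat[of _ "n - 1" p _ 0 _ n]) auto
    have cM: "?M *\<^sub>v (col Q l @\<^sub>v col X l) = (c \<cdot>\<^sub>v col Q l) @\<^sub>v (?H *\<^sub>v col X l)"
    proof -
      have "c \<cdot>\<^sub>m 1\<^sub>m (n - 1) *\<^sub>v col Q l = c \<cdot>\<^sub>v col Q l"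
        using smult_mat_mult_vec[of "1\<^sub>m (n - 1)" "n - 1" "n - 1" "col Q l" c] q by simp
      moreover have "0\<^sub>m (n - 1) n *\<^sub>v col X l = 0\<^sub>v (n - 1)" "0\<^sub>m n (n - 1) *\<^sub>v col Q l = 0\<^sub>v n"
        using q x by (auto intro!: eq_vecI)
      ultimately show ?thesis unfolding metric_mat_def
        using q x Hc by (subst four_block_mat_mult_vec[of _ "n - 1" "n - 1" _ n _ n]) auto
    qed
    have "?Z\<^sup>T * ?M * ?Z = ?Z\<^sup>T * (?M * ?Z)" using Z M by (intro assoc_mult_mat) auto
    hence "(?Z\<^sup>T * ?M * ?Z) $$ (l, l) = col ?Z l \<bullet> (?M *\<^sub>v col ?Z l)"
      using Z M l by (simp del: col_mult add: col_mult2[of _ "n - 1 + n" "n - 1 + n"])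
    also have "\<dots> = col Q l \<bullet> (c \<cdot>\<^sub>v col Q l) + col X l \<bullet> (?H *\<^sub>v col X l)"
      unfolding cZ cM using q x Hc by (subst scalar_prod_append[of _ "n - 1" _ n]) auto
    finally show ?thesis using q by simp
  qed
  have "mat_trace (?Z\<^sup>T * ?M * ?Z) =
      (\<Sum>l<p. c * (col Q l \<bullet> col Q l) + col X l \<bullet> (?H *\<^sub>v col X l))" (is "_ = ?E")
    unfolding mat_trace_def using Z ent by simp
  moreover have "?E \<ge> 0" using H c X scalar_prod_self_nonneg
    by (intro sum_nonneg add_nonneg_nonneg mult_nonneg_nonneg) (auto simp: pos_semidef_def)
  ultimately show ?thesis by (simp add: mat_seminorm_def)
qed

lemma append_rows_minus:
  assumes "Q \<in> carrier_mat m p" "Q' \<in> carrier_mat m p" "X \<in> carrier_mat n p" "X' \<in> carrier_mat n p"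
  shows "(Q @\<^sub>r X) - (Q' @\<^sub>r X') = ((Q - Q') @\<^sub>r (X - X') :: real mat)"
  using assms by (intro eq_matI) (auto simp: append_rows_def)

lemma seminorm_z_mat_diff:
  assumes "pos_semidef n (B - c \<cdot>\<^sub>m W)" "c \<ge> 0"
    and q: "q \<in> carrier_mat (n - 1) p" "qs \<in> carrier_mat (n - 1) p"
  shows "(mat_seminorm (metric_mat n c B W) (z_mat n p f q x - z_mat n p f qs xs))\<^sup>2 =
    (\<Sum>l<p. c * (col (q - qs) l \<bullet> col (q - qs) l)
      + col (grad_rows n p f x - grad_rows n p f xs) l
        \<bullet> ((B - c \<cdot>\<^sub>m W) *\<^sub>v col (grad_rows n p f x - grad_rows n p f xs) l))"
proof -
  have g: "grad_rows n p f X \<in> carrier_mat n p" for X by (simp add: grad_rows_def)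
  show ?thesis unfolding z_mat_def append_rows_minus[OF q g g]
    by (rule seminorm_append_rows[OF minus_carrier_mat[OF q(2)] minus_carrier_mat[OF g] assms(1,2)])
qed

text \<open>
  The linear algebra of a step acts on columns, the convexity of \<open>f i\<close> on rows. Summed over all columns,
  the remainder terms of the column estimates are the same as summed over all rows, where \<open>bound\<close>
  makes each of them nonpositive.
\<close>

lemma mirror_p_extra_energy_contraction:
  fixes \<mu> L :: real
  assumes run: "mirror_p_extra n p G W f r (\<lambda>_. \<beta>) c x s y"
    and G: "connected_graph_on n G" and compat: "graph_compatible n G W"
    and U: "(U::real mat) \<in> carrier_mat m n" and W: "W = U\<^sup>T * U"
    and \<beta>: "\<beta> > 0" and c: "c > 0" and r: "r \<in> carrier_mat n p"
    and q: "q (-1) = 0\<^sub>m m p" "\<And>k. q (int k) = q (int k - 1) + U * grad_rows n p f (x k)"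
    and xs: "xs \<in> carrier_mat n p" and qs: "qs \<in> carrier_mat m p"
    and kkt: "xs - r + c \<cdot>\<^sub>m (U\<^sup>T * qs) = 0\<^sub>m n p"
    and consensus: "U * grad_rows n p f xs = 0\<^sub>m m p"
    and f: "\<And>i. i < n \<Longrightarrow> differentiable_vec p (f i)"
    and bound: "\<And>i u v. i < n \<Longrightarrow> u \<in> carrier_vec p \<Longrightarrow> v \<in> carrier_vec p \<Longrightarrow>
      \<mu> * ((u - v) \<bullet> (u - v)) + 1 / L * ((grad p (f i) u - grad p (f i) v) \<bullet> (grad p (f i) u - grad p (f i) v))
      \<le> 2 * ((grad p (f i) u - grad p (f i) v) \<bullet> (u - v))"
    and H0: "pos_semidef n (mat_diag n (\<lambda>_. \<beta>) - c \<cdot>\<^sub>m W)"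
      "\<And>v. v \<in> carrier_vec n \<Longrightarrow> v \<bullet> ((mat_diag n (\<lambda>_. \<beta>) - c \<cdot>\<^sub>m W) *\<^sub>v v) \<le> \<beta> * (v \<bullet> v)"
    and lam: "lam > 0" "\<And>v. v \<in> carrier_vec m \<Longrightarrow> lam * (v \<bullet> v) \<le> (U\<^sup>T *\<^sub>v v) \<bullet> (U\<^sup>T *\<^sub>v v)"
    and \<delta>: "\<delta> \<ge> 0" "\<delta> * (2 / (c * lam)) \<le> \<mu>" "\<delta> * (2 * \<beta> / (c * lam)) \<le> 1" "\<delta> * \<beta> \<le> 1 / L"
  defines "H \<equiv> mat_diag n (\<lambda>_. \<beta>) - c \<cdot>\<^sub>m W"
  defines "E \<equiv> \<lambda>k. \<Sum>l<p. c * (col (q (int k) - qs) l \<bullet> col (q (int k) - qs) l)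
     + col (grad_rows n p f (x k) - grad_rows n p f xs) l
         \<bullet> (H *\<^sub>v col (grad_rows n p f (x k) - grad_rows n p f xs) l)"
  shows "(1 + \<delta>) * E (Suc k) \<le> E k"
proof -
  let ?g = "\<lambda>k. grad_rows n p f (x k)" and ?gs = "grad_rows n p f xs"
  have xk: "x k \<in> carrier_mat n p" for k using run by (auto simp: mirror_p_extra_def)
  have gc: "grad_rows n p f X \<in> carrier_mat n p" for X by (simp add: grad_rows_def)
  have qc: "q (int k) \<in> carrier_mat m p" for k using q_carrier[OF U q, of "Suc k"] by simp
  have col_minus: "col (A - B) l = col A l - col B l"
    if "A \<in> carrier_mat i p" "B \<in> carrier_mat i p" "l < p" for A B :: "real mat" and i l
    using that by (intro eq_vecI) auto
  define dx where "dx = x (Suc k) - xs"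
  define e where "e = ?g (Suc k) - ?gs"
  have dx: "dx \<in> carrier_mat n p" unfolding dx_def by (rule minus_carrier_mat[OF xs])
  have e: "e \<in> carrier_mat n p" unfolding e_def by (rule minus_carrier_mat[OF gc])
  have column: "(1 + \<delta>) * (c * (col (q (int (Suc k)) - qs) l \<bullet> col (q (int (Suc k)) - qs) l)
        + col e l \<bullet> (H *\<^sub>v col e l))
      \<le> c * (col (q (int k) - qs) l \<bullet> col (q (int k) - qs) l)
        + col (?g k - ?gs) l \<bullet> (H *\<^sub>v col (?g k - ?gs) l)
        + (\<mu> * (col dx l \<bullet> col dx l) + 1 / L * (col e l \<bullet> col e l) - 2 * (col e l \<bullet> col dx l))"
    if l: "l < p" for l
  proof -
    let ?a = "col (q (int (Suc k)) - qs) l" and ?d = "col (?g (Suc k)) l - col (?g k) l"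
    have a: "?a \<in> carrier_vec m" by (rule col_carrier_vec[OF l minus_carrier_mat[OF qs]])
    have d: "?d \<in> carrier_vec n" using gc l by simp
    have ec: "col e l \<in> carrier_vec n" and dxc: "col dx l \<in> carrier_vec n" using e dx l by auto
    have step: "H *\<^sub>v ?d = - (col dx l + c \<cdot>\<^sub>v (U\<^sup>T *\<^sub>v ?a))"
      unfolding H_def dx_def
      by (rule mirror_p_extra_column_step[OF run G compat U W \<beta> r f q xs qs kkt l])
    have "col e l - ?d = col (?g k - ?gs) l"
      unfolding e_def using gc l by (intro eq_vecI) (auto simp: grad_rows_def)
    \<comment> \<open>\<open>U e\<close> is the increment of \<open>q\<close>, because \<open>U\<close> annihilates the optimal gradients.\<close>
    moreover have "?a - U *\<^sub>v col e l = col (q (int k) - qs) l"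
    proof -
      have "U * ?gs = 0\<^sub>m m p" by (rule consensus)
      hence "U *\<^sub>v col ?gs l = 0\<^sub>v m" using col_mult2[OF U gc[of xs] l] l by simp
      moreover have "U *\<^sub>v col e l = U *\<^sub>v col (?g (Suc k)) l - U *\<^sub>v col ?gs l"
        unfolding e_def col_minus[OF gc gc l]
        using U gc l by (intro mult_minus_distrib_mat_vec[of _ m n]) auto
      moreover have "U *\<^sub>v col (?g (Suc k)) l = col (U * ?g (Suc k)) l"
        using col_mult2[OF U gc[of "x (Suc k)"] l] by simp
      moreover have "col (U * ?g (Suc k)) l - 0\<^sub>v m = col (U * ?g (Suc k)) l"
        using U by (intro eq_vecI) (auto simp del: index_mult_mat(1))
      ultimately have Ue: "U *\<^sub>v col e l = col (U * ?g (Suc k)) l" by simp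
      have "q (int (Suc k)) = q (int k) + U * ?g (Suc k)" using q(2)[of "Suc k"] by simp
      moreover have "col (A + P - B) l - col P l = col (A - B) l"
        if "A \<in> carrier_mat m p" "P \<in> carrier_mat m p" "B \<in> carrier_mat m p" for A B P :: "real mat"
        using that l by (intro eq_vecI) auto
      ultimately show ?thesis
        unfolding Ue using qc[of k] qs mult_carrier_mat[OF U gc[of "x (Suc k)"]] by simp
    qed
    ultimately show ?thesis
      using prox_step_contraction[OF U H0(1)[folded H_def] \<beta> H0(2)[folded H_def] c lam(1) lam(2)[OF a] a ec d dxc step \<delta>]
      by auto
  qed
  have "(\<Sum>l<p. \<mu> * (col dx l \<bullet> col dx l) + 1 / L * (col e l \<bullet> col e l) - 2 * (col e l \<bullet> col dx l))
      = (\<Sum>i<n. \<mu> * (row dx i \<bullet> row dx i) + 1 / L * (row e i \<bullet> row e i) - 2 * (row e i \<bullet> row dx i))"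
    using sum_col_prod_eq_sum_row_prod[OF dx dx] sum_col_prod_eq_sum_row_prod[OF e e]
      sum_col_prod_eq_sum_row_prod[OF e dx]
    by (simp only: sum.distrib sum_subtractf sum_distrib_left[symmetric])
  also have "\<dots> \<le> 0"
  proof (rule sum_nonpos)
    fix i assume "i \<in> {..<n}"
    hence i: "i < n" by simp
    have "row dx i = row (x (Suc k)) i - row xs i"
      unfolding dx_def using xk[of "Suc k"] xs i by (intro eq_vecI) auto
    moreover have "row e i = row (?g (Suc k)) i - row ?gs i"
      unfolding e_def using gc i by (intro eq_vecI) (auto simp: grad_rows_def)
    hence "row e i = grad p (f i) (row (x (Suc k)) i) - grad p (f i) (row xs i)"
      using row_grad_rows[of p f i _ n] f[OF i] xk[of "Suc k"] xs i by simp
    ultimately show "\<mu> * (row dx i \<bullet> row dx i) + 1 / L * (row e i \<bullet> row e i) - 2 * (row e i \<bullet> row dx i) \<le> 0"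
      using bound[OF i, of "row (x (Suc k)) i" "row xs i"] xk[of "Suc k"] xs i by simp
  qed
  finally have rows: "(\<Sum>l<p. \<mu> * (col dx l \<bullet> col dx l) + 1 / L * (col e l \<bullet> col e l)
      - 2 * (col e l \<bullet> col dx l)) \<le> 0" .
  have "(1 + \<delta>) * E (Suc k) \<le> E k + (\<Sum>l<p. \<mu> * (col dx l \<bullet> col dx l) + 1 / L * (col e l \<bullet> col e l)
      - 2 * (col e l \<bullet> col dx l))"
    unfolding E_def sum_distrib_left sum.distrib[symmetric] e_def[symmetric]
    using column by (intro sum_mono) auto
  thus ?thesis using rows by linarith
qed

section \<open>Step sizes and the iteration count\<close>

text \<open>
  \<open>R\<close> is chosen so that \<open>c = 1 / sqrt (L \<mu> lam \<Lambda>)\<close>; then \<open>2 / (c lam) = 2 \<mu> R\<close> and \<open>c \<Lambda> = R / L\<close>, so that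
  the primal and the gradient condition both ask for \<open>\<delta> R\<close> to be bounded by a constant. The
  remaining condition bounds \<open>\<delta> \<Lambda> / lam\<close>, and both \<open>R\<close> and \<open>\<Lambda> / lam\<close> are at most \<open>1 / (3 \<delta>)\<close>.
\<close>

lemma stepsize_choice:
  fixes lam \<Lambda> \<mu> L :: real
  assumes lam: "0 < lam" "lam \<le> \<Lambda>" and \<Lambda>: "1 \<le> \<Lambda>" and \<mu>: "0 < \<mu>" and L: "0 < L"
  defines "R \<equiv> sqrt (L * \<Lambda> / (\<mu> * lam))"
  defines "c \<equiv> R / (L * \<Lambda>)" and "\<delta> \<equiv> 1 / (3 * (\<Lambda> * (1 / lam + sqrt (1 / lam * (L / \<mu>)))))"
  shows "c > 0" "0 < \<delta>" "\<delta> \<le> 1" "\<delta> * (2 / (c * lam)) \<le> \<mu>"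
    "\<delta> * (2 * (c * \<Lambda>) / (c * lam)) \<le> 1" "\<delta> * (c * \<Lambda>) \<le> 1 / L"
proof -
  define S where "S = sqrt (1 / lam * (L / \<mu>))"
  define T where "T = \<Lambda> * (1 / lam + S)"
  have R: "R > 0" "R\<^sup>2 = L * \<Lambda> / (\<mu> * lam)" using assms(1-5) by (auto simp: R_def)
  have S: "S > 0" using assms(1-5) by (simp add: S_def)
  have "sqrt \<Lambda> \<le> \<Lambda>" using \<Lambda> by (intro real_le_lsqrt) (auto simp: power2_eq_square)
  moreover have "R = sqrt \<Lambda> * S"
    unfolding R_def S_def real_sqrt_mult[symmetric] by (simp add: field_simps)
  ultimately have "R \<le> \<Lambda> * S" using S by simp
  moreover have "\<Lambda> * S \<le> T" "\<Lambda> / lam \<le> T"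
    using \<Lambda> lam S by (auto simp: T_def distrib_left)
  ultimately have RT: "R \<le> T" and \<Lambda>T: "\<Lambda> / lam \<le> T" by auto
  have "1 \<le> \<Lambda> / lam" using lam by simp
  hence T: "T \<ge> 1" using \<Lambda>T by linarith
  have \<delta>: "\<delta> = 1 / (3 * T)" by (simp add: \<delta>_def T_def S_def)
  have third: "\<delta> * a \<le> 1 / 3" if "a \<le> T" for a
    using that T by (simp add: \<delta> pos_divide_le_eq)
  have \<delta>R: "\<delta> * R \<le> 1 / 3" and \<delta>\<Lambda>: "\<delta> * (\<Lambda> / lam) \<le> 1 / 3"
    by (rule third[OF RT], rule third[OF \<Lambda>T])
  show c: "c > 0" using R L \<Lambda> by (simp add: c_def)
  show "0 < \<delta>" "\<delta> \<le> 1" using T by (simp_all add: \<delta>)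
  have "2 / (c * lam) = 2 * \<mu> * R"
  proof -
    have "\<mu> * lam * (R * R) = L * \<Lambda>" using R(2) \<mu> lam by (simp add: power2_eq_square)
    thus ?thesis using R L \<Lambda> lam by (simp add: c_def field_simps)
  qed
  hence "\<delta> * (2 / (c * lam)) = 2 * \<mu> * (\<delta> * R)" by simp
  also have "\<dots> \<le> 2 * \<mu> * (1 / 3)" using \<delta>R \<mu> by (intro mult_left_mono) auto
  also have "\<dots> \<le> \<mu>" using \<mu> by simp
  finally show "\<delta> * (2 / (c * lam)) \<le> \<mu>" .
  have "\<delta> * (2 * (c * \<Lambda>) / (c * lam)) = 2 * (\<delta> * (\<Lambda> / lam))" using c by simp
  thus "\<delta> * (2 * (c * \<Lambda>) / (c * lam)) \<le> 1" using \<delta>\<Lambda> by linarith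
  have "c * \<Lambda> = R / L" using \<Lambda> by (simp add: c_def)
  hence "\<delta> * (c * \<Lambda>) = (\<delta> * R) / L" by simp
  also have "\<dots> \<le> 1 / L" using \<delta>R L by (intro divide_right_mono) auto
  finally show "\<delta> * (c * \<Lambda>) \<le> 1 / L" .
qed

text \<open>
  For \<open>\<delta> \<le> 1\<close> the factor \<open>1 + \<delta>\<close> is at least \<open>exp (\<delta> / 2)\<close>.
\<close>

lemma geometric_decay_iterations:
  fixes E :: "nat \<Rightarrow> real"
  assumes step: "\<And>k. (1 + \<delta>) * E (Suc k) \<le> E k" and nonneg: "\<And>k. E k \<ge> 0"
    and \<delta>: "0 < \<delta>" "\<delta> \<le> 1" and \<epsilon>: "0 < \<epsilon>" and k: "real k \<ge> 2 / \<delta> * ln (1 / \<epsilon>)"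
  shows "E k \<le> \<epsilon> * E 0"
proof -
  have decay: "(1 + \<delta>) ^ j * E j \<le> E 0" for j
  proof (induction j)
    case (Suc j)
    have "(1 + \<delta>) ^ j * ((1 + \<delta>) * E (Suc j)) \<le> (1 + \<delta>) ^ j * E j"
      using \<delta> by (intro mult_left_mono step) auto
    thus ?case using Suc by (simp add: mult_ac)
  qed simp
  have "exp (\<delta> / 2) \<le> 1 + \<delta>"
    using exp_bound_lemma[of "\<delta> / 2"] \<delta> by simp
  hence "exp (\<delta> / 2) ^ k \<le> (1 + \<delta>) ^ k" by (intro power_mono) auto
  moreover have "ln (1 / \<epsilon>) \<le> real k * (\<delta> / 2)" using k \<delta> by (simp add: field_simps)
  hence "1 / \<epsilon> \<le> exp (\<delta> / 2) ^ k"
    using \<epsilon> by (simp add: exp_of_nat_mult[symmetric] ln_ge_iff[symmetric] ln_le_cancel_iff[symmetric] del: ln_le_cancel_iff)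
  ultimately have "1 / \<epsilon> \<le> (1 + \<delta>) ^ k" by linarith
  hence "1 / \<epsilon> * E k \<le> (1 + \<delta>) ^ k * E k" using nonneg by (rule mult_right_mono)
  also have "\<dots> \<le> E 0" by (rule decay)
  finally show ?thesis using \<epsilon> by (simp add: field_simps)
qed

text \<open>
  The constant: \<open>stepsize_choice\<close> allows \<open>1 / \<delta> = 3 K\<close>, and \<open>geometric_decay_iterations\<close> asks for
  \<open>2 / \<delta>\<close> steps per unit of \<open>ln (1 / \<epsilon>)\<close>.
\<close>

lemma mirror_p_extra_linear_convergence:
  fixes n p :: nat and \<mu> Lc :: "nat \<Rightarrow> real"
  assumes n: "n \<ge> 2" and p: "p \<ge> 1" and G: "connected_graph_on n G"
    and U: "factor_cond n U" and W: "W = U\<^sup>T * U" and compat: "graph_compatible n G W"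
    and r: "r \<in> carrier_mat n p"
    and f: "\<And>i. i < n \<Longrightarrow> \<mu> i > 0 \<and> strongly_convex p (\<mu> i) (f i) \<and> lipschitz_gradient p (Lc i) (f i)"
  defines "K \<equiv> max 1 (max_eigenvalue W) * (kappa_L W + sqrt (kappa_L W * kappa_f n \<mu> Lc))"
  shows "\<exists>\<beta> c. \<beta> > 0 \<and> c > 0 \<and> loewner_ge n (mat_diag n (\<lambda>_. \<beta>)) (c \<cdot>\<^sub>m W) \<and>
    (\<forall>x s y q xs qs \<epsilon> (k::nat). mirror_p_extra n p G W f r (\<lambda>_. \<beta>) c x s y \<longrightarrow>
       q_sequence n p U f x q \<longrightarrow> optimal_allocation n p f r xs \<longrightarrow>
       qs \<in> carrier_mat (n - 1) p \<longrightarrow> xs - r + c \<cdot>\<^sub>m (U\<^sup>T * qs) = 0\<^sub>m n p \<longrightarrow>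
       0 < \<epsilon> \<longrightarrow> real k \<ge> 6 * K * ln (1 / \<epsilon>) \<longrightarrow>
       (mat_seminorm (metric_mat n c (mat_diag n (\<lambda>_. \<beta>)) W)
          (z_mat n p f (q (int k)) (x k) - z_mat n p f qs xs))\<^sup>2
       \<le> \<epsilon> * (mat_seminorm (metric_mat n c (mat_diag n (\<lambda>_. \<beta>)) W)
          (z_mat n p f (q 0) (x 0) - z_mat n p f qs xs))\<^sup>2)"
proof -
  define m where "m = n - 1"
  have m: "m > 0" using n by (simp add: m_def)
  have Uc: "U \<in> carrier_mat m n" and rank: "vec_space.rank m U = m"
    and ker: "mat_kernel U = {a \<cdot>\<^sub>v vec n (\<lambda>_. 1) | a. True}"
    using U by (simp_all add: factor_cond_def m_def)
  have ones: "U *\<^sub>v vec n (\<lambda>_. 1) = 0\<^sub>v m"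
  proof -
    have "1 \<cdot>\<^sub>v vec n (\<lambda>_. 1) \<in> mat_kernel U" unfolding ker by blast
    thus ?thesis using Uc by (auto simp: mat_kernel_def)
  qed
  have Wc: "W \<in> carrier_mat n n" using Uc by (simp add: W)
  have WT: "W\<^sup>T = W" using Uc by (simp add: W transpose_mult[of _ n m _ n])
  have W0: "0 \<le> v \<bullet> (W *\<^sub>v v)" if v: "v \<in> carrier_vec n" for v
  proof -
    have Uv: "U *\<^sub>v v \<in> carrier_vec m" using Uc v by simp
    have "W *\<^sub>v v = U\<^sup>T *\<^sub>v (U *\<^sub>v v)" using Uc v by (simp add: W)
    hence "v \<bullet> (W *\<^sub>v v) = (U *\<^sub>v v) \<bullet> (U *\<^sub>v v)"
      using transpose_vec_mult_scalar[OF Uc v Uv] v Uc Uv by (simp add: comm_scalar_prod[of _ n])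
    thus ?thesis using scalar_prod_self_nonneg by simp
  qed
  define lam where "lam = min_nonzero_eigenvalue W"
  define \<Lambda> where "\<Lambda> = max 1 (max_eigenvalue W)"
  have lam: "lam > 0" "lam \<le> \<Lambda>"
    "\<And>v. v \<in> carrier_vec m \<Longrightarrow> lam * (v \<bullet> v) \<le> (U\<^sup>T *\<^sub>v v) \<bullet> (U\<^sup>T *\<^sub>v v)"
    using nonzero_spectrum_gram[OF Uc m rank] by (auto simp: lam_def \<Lambda>_def W)
  have \<Lambda>: "1 \<le> \<Lambda>" by (simp add: \<Lambda>_def)
  have W1: "v \<bullet> (W *\<^sub>v v) \<le> \<Lambda> * (v \<bullet> v)" if v: "v \<in> carrier_vec n" for v
  proof -
    have "max_eigenvalue W * (v \<bullet> v) \<le> \<Lambda> * (v \<bullet> v)"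
      by (intro mult_right_mono scalar_prod_self_nonneg) (simp add: \<Lambda>_def)
    thus ?thesis using symmetric_max_eigenvalue[OF Wc WT v] by linarith
  qed
  define \<mu>0 where "\<mu>0 = Min (\<mu> ` {..<n})"
  define L where "L = Max (Lc ` {..<n})"
  have "0 \<in> {..<n}" using n by simp
  hence ne: "{..<n} \<noteq> {}" by blast
  have \<mu>le: "\<mu>0 \<le> \<mu> i" and Lge: "Lc i \<le> L" if "i < n" for i
    using that by (auto simp: \<mu>0_def L_def)
  have "\<mu>0 \<in> \<mu> ` {..<n}" unfolding \<mu>0_def using ne by (intro Min_in) auto
  hence \<mu>0: "\<mu>0 > 0" using f by auto
  have L: "L > 0"
  proof -
    have "\<mu> 0 \<le> Lc 0" using strong_convexity_le_lipschitz[OF _ _ p] f[of 0] n by auto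
    thus ?thesis using f[of 0] Lge[of 0] n by linarith
  qed
  define c where "c = sqrt (L * \<Lambda> / (\<mu>0 * lam)) / (L * \<Lambda>)"
  define \<beta> where "\<beta> = c * \<Lambda>"
  define \<delta> where "\<delta> = 1 / (3 * (\<Lambda> * (1 / lam + sqrt (1 / lam * (L / \<mu>0)))))"
  note steps = stepsize_choice[OF lam(1,2) \<Lambda> \<mu>0 L, folded c_def \<delta>_def, folded \<beta>_def]
  have c: "c > 0" by (rule steps)
  have \<beta>: "\<beta> > 0" using c \<Lambda> by (simp add: \<beta>_def)
  have K: "6 * K = 2 / \<delta>"
    by (simp add: K_def \<delta>_def kappa_L_def kappa_f_def \<Lambda>_def lam_def \<mu>0_def L_def)
  have H: "pos_semidef n (mat_diag n (\<lambda>_. \<beta>) - c \<cdot>\<^sub>m W)"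
    by (rule scaled_identity_minus_psd(1)[OF Wc WT W0 W1 c]) (simp_all add: \<beta>_def)
  have H\<beta>: "v \<bullet> ((mat_diag n (\<lambda>_. \<beta>) - c \<cdot>\<^sub>m W) *\<^sub>v v) \<le> \<beta> * (v \<bullet> v)"
    if "v \<in> carrier_vec n" for v
    by (rule scaled_identity_minus_psd(2)[OF Wc WT W0 W1 c]) (use that in \<open>simp_all add: \<beta>_def\<close>)
  have df: "differentiable_vec p (f i)" if "i < n" for i
    using f[OF that] by (simp add: strongly_convex_def)
  have decay: "(mat_seminorm (metric_mat n c (mat_diag n (\<lambda>_. \<beta>)) W)
          (z_mat n p f (q (int k)) (x k) - z_mat n p f qs xs))\<^sup>2
       \<le> \<epsilon> * (mat_seminorm (metric_mat n c (mat_diag n (\<lambda>_. \<beta>)) W)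
          (z_mat n p f (q 0) (x 0) - z_mat n p f qs xs))\<^sup>2"
    if run: "mirror_p_extra n p G W f r (\<lambda>_. \<beta>) c x s y"
      and qseq: "q_sequence n p U f x q" and opt: "optimal_allocation n p f r xs"
      and qs: "qs \<in> carrier_mat (n - 1) p" and kkt: "xs - r + c \<cdot>\<^sub>m (U\<^sup>T * qs) = 0\<^sub>m n p"
      and \<epsilon>: "0 < \<epsilon>" and k: "real k \<ge> 6 * K * ln (1 / \<epsilon>)" for x s y q xs qs \<epsilon> and k :: nat
  proof -
    have q: "q (-1) = 0\<^sub>m m p" "\<And>k. q (int k) = q (int k - 1) + U * grad_rows n p f (x k)"
      using qseq by (auto simp: q_sequence_def m_def)
    have qs': "qs \<in> carrier_mat m p" using qs by (simp add: m_def)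
    have xs: "xs \<in> carrier_mat n p"
      using opt by (simp add: optimal_allocation_def is_arg_min_def)
    have qc: "q (int k) \<in> carrier_mat (n - 1) p" for k
      using q_carrier[OF Uc q, of "Suc k"] by (simp add: m_def)
    have consensus: "U * grad_rows n p f xs = 0\<^sub>m m p"
      by (rule optimal_allocation_gradients_agree[OF opt Uc ones df])
    have bound: "\<mu>0 * ((u - v) \<bullet> (u - v)) + 1 / L * ((grad p (f i) u - grad p (f i) v) \<bullet> (grad p (f i) u - grad p (f i) v))
        \<le> 2 * ((grad p (f i) u - grad p (f i) v) \<bullet> (u - v))"
      if "i < n" "u \<in> carrier_vec p" "v \<in> carrier_vec p" for i u v
      using strongly_convex_cocoercive_bound[OF _ _ \<mu>0 \<mu>le[OF that(1)] L Lge[OF that(1)] that(2,3)]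
        f[OF that(1)] by blast
    define E where "E = (\<lambda>k. (mat_seminorm (metric_mat n c (mat_diag n (\<lambda>_. \<beta>)) W)
          (z_mat n p f (q (int k)) (x k) - z_mat n p f qs xs))\<^sup>2)"
    have "(1 + \<delta>) * E (Suc j) \<le> E j" for j
      unfolding E_def seminorm_z_mat_diff[OF H less_imp_le[OF c] qc qs]
      using steps(2)
      by (intro mirror_p_extra_energy_contraction[OF run G compat Uc W \<beta> c r q xs qs' kkt consensus df
          bound H H\<beta> lam(1,3) _ steps(4-6)]) auto
    hence "E k \<le> \<epsilon> * E 0"
      using steps(2,3) \<epsilon> k K by (intro geometric_decay_iterations[of \<delta>]) (auto simp: E_def)
    thus ?thesis by (simp add: E_def)
  qed
  have "loewner_ge n (mat_diag n (\<lambda>_. \<beta>)) (c \<cdot>\<^sub>m W)" using H by (simp add: loewner_ge_def)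
  thus ?thesis using \<beta> c decay by blast
qed

theorem corollary1:
  shows "\<exists>C::real. C > 0 \<and>
    (\<forall>(n::nat) (p::nat) (G::nat pair_pre_digraph) (U::real mat) (W::real mat)
       (f::nat \<Rightarrow> real vec \<Rightarrow> real) (r::real mat) (\<mu>::nat \<Rightarrow> real) (Lc::nat \<Rightarrow> real).
       n \<ge> 2 \<longrightarrow> p \<ge> 1 \<longrightarrow>
       connected_graph_on n G \<longrightarrow>
       factor_cond n U \<longrightarrow> W = U\<^sup>T * U \<longrightarrow> graph_compatible n G W \<longrightarrow>
       r \<in> carrier_mat n p \<longrightarrow>
       (\<forall>i<n. \<mu> i > 0 \<and> strongly_convex p (\<mu> i) (f i) \<and> lipschitz_gradient p (Lc i) (f i)) \<longrightarrow>
       (\<exists>(\<beta>::real) (c::real). \<beta> > 0 \<and> c > 0 \<and>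
          loewner_ge n (mat_diag n (\<lambda>_. \<beta>)) (c \<cdot>\<^sub>m W) \<and>
          (\<forall>(x::nat \<Rightarrow> real mat) (s::nat \<Rightarrow> real mat) (y::int \<Rightarrow> real mat) (q::int \<Rightarrow> real mat)
             (xs::real mat) (qs::real mat).
             mirror_p_extra n p G W f r (\<lambda>_. \<beta>) c x s y \<longrightarrow>
             q_sequence n p U f x q \<longrightarrow>
             optimal_allocation n p f r xs \<longrightarrow>
             qs \<in> carrier_mat (n - 1) p \<longrightarrow>
             xs - r + c \<cdot>\<^sub>m (U\<^sup>T * qs) = 0\<^sub>m n p \<longrightarrow>
             (\<forall>(\<epsilon>::real) (k::nat). 0 < \<epsilon> \<longrightarrow> \<epsilon> < 1 \<longrightarrow>
                real k \<ge> C * (max 1 (max_eigenvalue W)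
                                * (kappa_L W + sqrt (kappa_L W * kappa_f n \<mu> Lc))) * ln (1 / \<epsilon>) \<longrightarrow>
                (mat_seminorm (metric_mat n c (mat_diag n (\<lambda>_. \<beta>)) W)
                   (z_mat n p f (q (int k)) (x k) - z_mat n p f qs xs))\<^sup>2
                \<le> \<epsilon> * (mat_seminorm (metric_mat n c (mat_diag n (\<lambda>_. \<beta>)) W)
                         (z_mat n p f (q 0) (x 0) - z_mat n p f qs xs))\<^sup>2))))"
proof (rule exI[of _ "6::real"], intro conjI allI impI, goal_cases)
  case (2 n p G U W f r \<mu> Lc)
  then obtain \<beta> c where bc: "\<beta> > 0" "c > 0" "loewner_ge n (mat_diag n (\<lambda>_. \<beta>)) (c \<cdot>\<^sub>m W)"
    and conv: "\<And>x s y q xs qs \<epsilon> k. mirror_p_extra n p G W f r (\<lambda>_. \<beta>) c x s y \<Longrightarrow>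
       q_sequence n p U f x q \<Longrightarrow> optimal_allocation n p f r xs \<Longrightarrow>
       qs \<in> carrier_mat (n - 1) p \<Longrightarrow> xs - r + c \<cdot>\<^sub>m (U\<^sup>T * qs) = 0\<^sub>m n p \<Longrightarrow>
       0 < \<epsilon> \<Longrightarrow> real k \<ge> 6 * (max 1 (max_eigenvalue W)
           * (kappa_L W + sqrt (kappa_L W * kappa_f n \<mu> Lc))) * ln (1 / \<epsilon>) \<Longrightarrow>
       (mat_seminorm (metric_mat n c (mat_diag n (\<lambda>_. \<beta>)) W)
          (z_mat n p f (q (int k)) (x k) - z_mat n p f qs xs))\<^sup>2
       \<le> \<epsilon> * (mat_seminorm (metric_mat n c (mat_diag n (\<lambda>_. \<beta>)) W)
          (z_mat n p f (q 0) (x 0) - z_mat n p f qs xs))\<^sup>2"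
    using mirror_p_extra_linear_convergence[of n p G U W r \<mu> f Lc] by blast
  show ?case
    by (rule exI[of _ \<beta>], rule exI[of _ c], intro conjI allI impI bc) (rule conv)
qed simp

end
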